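(* Let $H$ be a $k$-dimensional linear subspace of $\mathbb{R}^{n+1}$ ($k\ge 1$) and let $a^l=(a^l_1,\dots,a^l_{n+1})$, $l=1,\dots,n+1-k$, be an orthonormal basis of $H^{\perp}$. Then $$\operatorname{vol}_{k-1}(H\cap S)=\frac{\sqrt{n+1-\sum_{l=1}^{n+1-k}\left(\sum_{j=1}^{n+1} a_j^l\right)^2}}{(k-1)!}\,\frac{1}{(2\pi)^{n+1-k}}\int_{\mathbb{R}^{n+1-k}}\prod_{j=1}^{n+1}\frac{1}{1+\mathrm{i}\left(\sum_{l=1}^{n+1-k}a_j^l s^l\right)}\,\mathrm{d}s,$$ where $s=(s^1,\dots,s^{n+1-k})$.
   Context: $S:=\{x\in\mathbb{R}^{n+1}\mid \sum_{j=1}^{n+1}x_j=1,\ x_j\ge 0\}$ is the regular $n$-simplex embedded in $\mathbb{R}^{n+1}$. For a subset $A$ of an $m$-dimensional affine subspace, $\operatorname{vol}_m(A)$ is the standard induced $m$-dimensional Lebesgue volume of that subspace; here $H\cap S$ lies in the $(k-1)$-dimensional affine subspace $H\cap\{\sum_j x_j=1\}$ (when nonempty). The superscripts $l$ in $a^l_j$ and $s^l$ are indices, not powers; $\mathrm{i}$ is the imaginary unit.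
   Formalization: Assumes in addition that H lies in no coordinate hyperplane {x_j = 0}; otherwise the integral does not converge absolutely, and as a principal value it gives half the volume, e.g. for H = {x_1 = 0}. *)

theory Defs
  imports "HOL-Analysis.Analysis"
begin

definition standard_simplex :: "(real ^ 'd) set" where
  "standard_simplex = {x. (\<Sum>j\<in>UNIV. x $ j) = 1 \<and> (\<forall>j. 0 \<le> x $ j)}"

definition orthonormal_family :: "'i set \<Rightarrow> ('i \<Rightarrow> 'a::real_inner) \<Rightarrow> bool" where
  "orthonormal_family I u \<longleftrightarrow>
     (\<forall>i\<in>I. \<forall>j\<in>I. u i \<bullet> u j = (if i = j then 1 else 0))"

definition orthonormal_basis_of :: "'i set \<Rightarrow> ('i \<Rightarrow> 'a::real_inner) \<Rightarrow> 'a set \<Rightarrow> bool" where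
  "orthonormal_basis_of I u V \<longleftrightarrow> orthonormal_family I u \<and> span (u ` I) = V"

text \<open>Lebesgue measure on the space of real families indexed by I. Unlike a type-indexed
  Euclidean space, this allows a variable dimension, including dimension 0, where it is the
  unit mass on a one-point space.\<close>

abbreviation lborel_on :: "'i set \<Rightarrow> ('i \<Rightarrow> real) measure" where
  "lborel_on I \<equiv> Pi\<^sub>M I (\<lambda>_. lborel)"

definition affine_chart ::
  "nat \<Rightarrow> 'a::real_inner \<Rightarrow> (nat \<Rightarrow> 'a) \<Rightarrow> (nat \<Rightarrow> real) \<Rightarrow> 'a" where
  "affine_chart m p u x = p + (\<Sum>i<m. x i *\<^sub>R u i)"

text \<open>The m-dimensional volume of a subset A of an m-dimensional affine subspace is the Lebesgue
  measure of A in orthonormal affine coordinates of such a subspace. Any choice of coordinates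
  gives the same value: two charts of one subspace differ by an isometry, and if A lies in two
  different m-dimensional subspaces, it is a null set in both. For m = 0 this counts points.
  The value is meaningless if A lies in no m-dimensional affine subspace.\<close>

definition affine_vol :: "nat \<Rightarrow> 'a::real_inner set \<Rightarrow> real" where
  "affine_vol m A =
     (let (p, u) = (SOME (p, u). orthonormal_family {..<m} u \<and> A \<subseteq> range (affine_chart m p u))
      in measure (completion (lborel_on {..<m}))
           {x \<in> space (lborel_on {..<m}). affine_chart m p u x \<in> A})"

end

theory Submission
  imports Defs "HOL-Probability.Probability"
begin

text \<open>
  Let \<open>m = n + 1 - k\<close>, let \<open>W\<close> be the orthogonal complement of \<open>H\<close>, and write \<open>\<sigma> = (\<Sum>l. s l *\<^sub>R a l)\<close> for the
  point of \<open>W\<close> with coordinates \<open>s\<close>. The integrand is the product of the factors \<open>1 / (1 + \<i> * \<sigma> $ j)\<close>, and each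
  factor is the Fourier transform of the exponential density on the half-line. Hence the integrand is the
  Fourier transform of the push-forward to \<open>W\<close> of the density \<open>exp (- (\<Sum>j. x $ j))\<close> on the positive
  orthant, and Fourier inversion at the origin says that its integral is \<open>(2 * pi) ^ m\<close> times the integral of
  this density over the fibre over 0, which is the cone in which \<open>H\<close> meets the orthant
  (\<open>integral_eq_cone_integral\<close>). The cone is sliced by the hyperplanes of constant coordinate sum. With \<open>\<rho>\<close> the
  length of the projection \<open>q\<close> of the all-ones vector to \<open>H\<close>, the slice of coordinate sum \<open>r\<close> has distance
  \<open>r / \<rho>\<close> from the origin and volume \<open>r ^ (k - 1)\<close> times that of the slice \<open>r = 1\<close>, which is the section of the
  simplex; so a Gamma integral produces the factor \<open>fact (k - 1) / \<rho>\<close>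
  (\<open>nn_integral_cone_density_slices\<close>). Finally \<open>\<rho>\<close> is the square root in the theorem, by Pythagoras. If
  \<open>\<rho> = 0\<close>, the coordinate sum vanishes on \<open>H\<close>, so the section is empty and both sides are 0.

  Absolute convergence is not obvious: the decay of the factors is only just insufficient if one keeps as
  many of them as \<open>W\<close> has dimensions. For each \<open>\<sigma>\<close> one chooses a set \<open>B\<close> of coordinates that form a basis of
  the dual space of \<open>W\<close>, with \<open>(\<Sum>j\<in>B. \<bar>\<sigma> $ j\<bar>)\<close> as small as possible. Nondegeneracy says that \<open>W\<close> contains no
  coordinate axis; therefore every element of \<open>B\<close> can be exchanged for a coordinate outside \<open>B\<close>, some factor
  outside \<open>B\<close> is as small as all those in \<open>B\<close>, and it supplies the missing decay
  (\<open>prod_inverse_le_sum_minimal_determining\<close>, \<open>integrable_prod_inverse_linear_form\<close>).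

  Inversion holds at the given point, rather than almost everywhere, because the integral of the density over
  the translate of \<open>H\<close> by \<open>y\<close> is continuous at \<open>y = 0\<close>: the boundary of the orthant meets \<open>H\<close> in a null set,
  again by nondegeneracy. The proof inserts the factors \<open>exp (- (\<epsilon> * s l)\<^sup>2 / 2)\<close>, exchanges the order of
  integration, and lets \<open>\<epsilon>\<close> tend to 0 by dominated convergence on both sides.

  Changes between orthonormal coordinates, and the linear substitution in the convergence proof, rest on the
  uniqueness of translation-invariant measures (\<open>translation_invariant_proportional_lborel\<close>). As the
  chart behind \<^const>\<open>affine_vol\<close> is an arbitrary choice, it must also be compared with the chart that the slicing uses
  (\<open>affine_vol_eq_measure_chart\<close>).
\<close>

section \<open>Lebesgue measure in orthonormal coordinates\<close>

lemma nn_integral_PiM_affine: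
  fixes f :: "('i \<Rightarrow> real) \<Rightarrow> ennreal" and c :: "'i \<Rightarrow> real"
  assumes "finite I" and r: "r \<noteq> 0" and "f \<in> borel_measurable (lborel_on I)"
  shows "(\<integral>\<^sup>+x. f x \<partial>lborel_on I) =
    ennreal (\<bar>r\<bar> ^ card I) * (\<integral>\<^sup>+x. f (\<lambda>i\<in>I. c i + r * x i) \<partial>lborel_on I)"
  using assms(1,3)
proof (induction I arbitrary: f rule: finite_induct)
  case empty
  interpret product_sigma_finite "\<lambda>_::'i. lborel :: real measure" by standard
  show ?case by (simp add: PiM_empty nn_integral_count_space_finite restrict_def)
next
  case (insert i I)
  interpret product_sigma_finite "\<lambda>_::'i. lborel :: real measure" by standard
  interpret I: finite_product_sigma_finite "\<lambda>_::'i. lborel :: real measure" I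
    by standard (rule insert.hyps)
  note insert.prems[measurable]
  have upd: "(\<lambda>j\<in>I. c j + r * x j)(i := c i + r * y) = (\<lambda>j\<in>insert i I. c j + r * (x(i := y)) j)"
    for x y using insert.hyps by (auto simp: fun_eq_iff)
  have "(\<lambda>(x, y). x(i := c i + r * y)) \<in> lborel_on I \<Otimes>\<^sub>M lborel \<rightarrow>\<^sub>M lborel_on (insert i I)"
    unfolding case_prod_unfold by (rule measurable_fun_upd[where J=I]) auto
  from measurable_compose[OF this insert.prems]
  have [measurable]: "(\<lambda>(x, y). f (x(i := c i + r * y))) \<in> borel_measurable (lborel_on I \<Otimes>\<^sub>M lborel)"
    by (simp add: case_prod_unfold)
  have m[measurable]: "(\<lambda>x. \<integral>\<^sup>+y. f (x(i := c i + r * y)) \<partial>lborel) \<in> borel_measurable (lborel_on I)"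
    by measurable
  have "(\<integral>\<^sup>+x. f x \<partial>lborel_on (insert i I)) = (\<integral>\<^sup>+x. \<integral>\<^sup>+y. f (x(i := y)) \<partial>lborel \<partial>lborel_on I)"
    by (rule product_nn_integral_insert) (use insert in auto)
  also have "\<dots> = (\<integral>\<^sup>+x. ennreal \<bar>r\<bar> * \<integral>\<^sup>+y. f (x(i := c i + r * y)) \<partial>lborel \<partial>lborel_on I)"
    by (intro nn_integral_cong nn_integral_real_affine r) auto
  also have "\<dots> = ennreal \<bar>r\<bar> * (\<integral>\<^sup>+x. \<integral>\<^sup>+y. f (x(i := c i + r * y)) \<partial>lborel \<partial>lborel_on I)"
    by (intro nn_integral_cmult) measurable
  also have "\<dots> = ennreal \<bar>r\<bar> * (ennreal (\<bar>r\<bar> ^ card I) *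
      (\<integral>\<^sup>+x. \<integral>\<^sup>+y. f ((\<lambda>j\<in>I. c j + r * x j)(i := c i + r * y)) \<partial>lborel \<partial>lborel_on I))"
    by (subst insert.IH[OF m]) simp
  also have "\<dots> = ennreal (\<bar>r\<bar> ^ card (insert i I)) *
      (\<integral>\<^sup>+x. \<integral>\<^sup>+y. f (\<lambda>j\<in>insert i I. c j + r * (x(i := y)) j) \<partial>lborel \<partial>lborel_on I)"
    using insert.hyps by (simp add: upd ennreal_mult'' mult.assoc)
  also have "(\<integral>\<^sup>+x. \<integral>\<^sup>+y. f (\<lambda>j\<in>insert i I. c j + r * (x(i := y)) j) \<partial>lborel \<partial>lborel_on I) =
      (\<integral>\<^sup>+x. f (\<lambda>j\<in>insert i I. c j + r * x j) \<partial>lborel_on (insert i I))"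
    by (rule product_nn_integral_insert[symmetric]) (use insert.hyps in \<open>auto intro!: measurable_compose[OF _ insert.prems] measurable_restrict\<close>)
  finally show ?case .
qed

lemma nn_integral_lborel_translate_reflect:
  fixes f :: "'a::euclidean_space \<Rightarrow> ennreal"
  assumes [measurable]: "f \<in> borel_measurable borel" and c: "\<bar>c\<bar> = 1"
  shows "(\<integral>\<^sup>+x. f (t + c *\<^sub>R x) \<partial>lborel) = (\<integral>\<^sup>+x. f x \<partial>lborel)"
proof -
  have "(\<integral>\<^sup>+x. f x \<partial>lborel) =
      (\<integral>\<^sup>+x. f x \<partial>density (distr lborel borel (\<lambda>x. t + c *\<^sub>R x)) (\<lambda>_. \<bar>c\<bar> ^ DIM('a)))"
    by (subst lborel_affine[of c t]) (use c in auto)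
  then show ?thesis
    by (simp add: c density_1 nn_integral_distr)
qed

text \<open>Uniqueness of translation-invariant measures. Integrate \<open>f x * g (x + y)\<close> over \<open>\<mu>\<close> in
  \<open>x\<close> and over Lebesgue measure in \<open>y\<close>. Invariance of Lebesgue measure in \<open>y\<close> gives the left-hand side;
  invariance of \<open>\<mu>\<close> in \<open>x\<close> turns the integrand into \<open>f (x - y) * g x\<close>, and the substitution
  \<open>y \<mapsto> x - y\<close> gives the right-hand side. A Gaussian is a convenient reference function \<open>g\<close>: it is bounded
  below on every ball, so that its finite integral makes \<open>\<mu>\<close> sigma-finite, and it depends on the norm
  alone, so that its integral can be computed in any orthonormal coordinates.\<close>

lemma translation_invariant_proportional_lborel:
  fixes \<mu> :: "'a::euclidean_space measure" and f :: "'a \<Rightarrow> ennreal"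
  defines "g \<equiv> \<lambda>x::'a. ennreal (exp (- (norm x)\<^sup>2))"
  assumes sets: "sets \<mu> = sets borel"
    and inv: "\<And>a F. F \<in> borel_measurable borel \<Longrightarrow> (\<integral>\<^sup>+x. F (a + x) \<partial>\<mu>) = (\<integral>\<^sup>+x. F x \<partial>\<mu>)"
    and fin: "(\<integral>\<^sup>+x. g x \<partial>\<mu>) < \<infinity>"
    and f[measurable]: "f \<in> borel_measurable borel"
  shows "(\<integral>\<^sup>+x. f x \<partial>\<mu>) * (\<integral>\<^sup>+x. g x \<partial>lborel) = (\<integral>\<^sup>+x. f x \<partial>lborel) * (\<integral>\<^sup>+x. g x \<partial>\<mu>)"
proof -
  have [measurable]: "g \<in> borel_measurable borel"
    unfolding g_def by measurable
  note [measurable_cong] = sets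
  have sp: "space \<mu> = UNIV"
    using sets_eq_imp_space_eq[OF sets] by simp
  have ball: "emeasure \<mu> (cball 0 (real n)) < \<infinity>" for n
  proof -
    have "emeasure \<mu> (cball 0 (real n)) = (\<integral>\<^sup>+x. indicator (cball 0 (real n)) x \<partial>\<mu>)"
      by (rule nn_integral_indicator[symmetric]) simp
    also have "\<dots> \<le> (\<integral>\<^sup>+x. ennreal (exp ((real n)\<^sup>2)) * g x \<partial>\<mu>)"
    proof (rule nn_integral_mono)
      fix x :: 'a
      have "1 \<le> exp ((real n)\<^sup>2) * exp (- (norm x)\<^sup>2)" if "norm x \<le> n"
        using power_mono[OF that, of 2] by (simp flip: exp_add)
      then show "indicator (cball 0 (real n)) x \<le> ennreal (exp ((real n)\<^sup>2)) * g x"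
        by (auto simp: g_def indicator_def simp flip: ennreal_mult)
    qed
    also have "\<dots> = ennreal (exp ((real n)\<^sup>2)) * (\<integral>\<^sup>+x. g x \<partial>\<mu>)"
      by (rule nn_integral_cmult) measurable
    also have "\<dots> < \<infinity>"
      using fin by (auto intro: ennreal_mult_less_top[THEN iffD2])
    finally show ?thesis .
  qed
  interpret \<mu>: sigma_finite_measure \<mu>
  proof
    show "\<exists>A. countable A \<and> A \<subseteq> sets \<mu> \<and> \<Union>A = space \<mu> \<and> (\<forall>a\<in>A. emeasure \<mu> a \<noteq> \<infinity>)"
      using ball by (intro exI[of _ "range (\<lambda>n. cball 0 (real n))"])
        (auto simp: sp less_top intro: real_arch_simple)
  qed
  interpret pair_sigma_finite \<mu> "lborel :: 'a measure" by standard
  have "(\<integral>\<^sup>+x. f x \<partial>\<mu>) * (\<integral>\<^sup>+x. g x \<partial>lborel) = (\<integral>\<^sup>+x. f x * (\<integral>\<^sup>+y. g (x + y) \<partial>lborel) \<partial>\<mu>)"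
    using nn_integral_lborel_translate_reflect[of g 1] by (simp add: nn_integral_multc)
  also have "\<dots> = (\<integral>\<^sup>+x. \<integral>\<^sup>+y. f x * g (x + y) \<partial>lborel \<partial>\<mu>)"
    by (simp add: nn_integral_cmult)
  also have "\<dots> = (\<integral>\<^sup>+y. \<integral>\<^sup>+x. f x * g (x + y) \<partial>\<mu> \<partial>lborel)"
    by (rule Fubini'[symmetric]) measurable
  also have "\<dots> = (\<integral>\<^sup>+y. \<integral>\<^sup>+x. f (x - y) * g x \<partial>\<mu> \<partial>lborel)"
  proof (rule nn_integral_cong)
    fix y
    show "(\<integral>\<^sup>+x. f x * g (x + y) \<partial>\<mu>) = (\<integral>\<^sup>+x. f (x - y) * g x \<partial>\<mu>)"
      using inv[of "\<lambda>x. f (x - y) * g x" y] by (simp add: add.commute)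
  qed
  also have "\<dots> = (\<integral>\<^sup>+x. \<integral>\<^sup>+y. f (x - y) * g x \<partial>lborel \<partial>\<mu>)"
    by (rule Fubini') measurable
  also have "\<dots> = (\<integral>\<^sup>+x. (\<integral>\<^sup>+y. f y \<partial>lborel) * g x \<partial>\<mu>)"
    using nn_integral_lborel_translate_reflect[of f "-1"] by (simp add: nn_integral_multc)
  also have "\<dots> = (\<integral>\<^sup>+x. f x \<partial>lborel) * (\<integral>\<^sup>+x. g x \<partial>\<mu>)"
    by (simp add: nn_integral_cmult)
  finally show ?thesis .
qed

lemma nn_integral_exp_square:
  assumes "b \<noteq> 0"
  shows "(\<integral>\<^sup>+t. ennreal (exp (- (b * t)\<^sup>2)) \<partial>lborel) = ennreal (sqrt pi / \<bar>b\<bar>)"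
proof -
  have "has_bochner_integral lborel (\<lambda>x::real. exp (- x\<^sup>2)) (sqrt pi)"
    using has_bochner_integral_even_function[OF gaussian_moment_0] by simp
  then have "ennreal (sqrt pi) = (\<integral>\<^sup>+t. ennreal (exp (- t\<^sup>2)) \<partial>lborel)"
    by (subst nn_integral_eq_integral)
      (auto simp: has_bochner_integral_iff)
  also have "\<dots> = ennreal \<bar>b\<bar> * (\<integral>\<^sup>+t. ennreal (exp (- (b * t)\<^sup>2)) \<partial>lborel)"
    using nn_integral_real_affine[of "\<lambda>t. ennreal (exp (- t\<^sup>2))" b 0] assms by simp
  finally have *: "ennreal (sqrt pi) = ennreal \<bar>b\<bar> * (\<integral>\<^sup>+t. ennreal (exp (- (b * t)\<^sup>2)) \<partial>lborel)" .
  show ?thesis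
    by (rule ennreal_mult_cancel_left[where a="ennreal \<bar>b\<bar>", THEN iffD1, THEN disjE])
      (use * assms in \<open>auto simp flip: ennreal_mult'\<close>)
qed

lemma nn_integral_exp_norm_square:
  assumes "b \<noteq> 0"
  shows "(\<integral>\<^sup>+x. ennreal (exp (- (b * norm (x :: 'a::euclidean_space))\<^sup>2)) \<partial>lborel) =
    ennreal (sqrt pi / \<bar>b\<bar>) ^ DIM('a)"
proof -
  have "ennreal (exp (- (b * norm x)\<^sup>2)) = (\<Prod>i\<in>Basis. ennreal (exp (- (b * (x \<bullet> i))\<^sup>2)))" for x :: 'a
  proof -
    have "(b * norm x)\<^sup>2 = (\<Sum>i\<in>Basis. (b * (x \<bullet> i))\<^sup>2)"
      unfolding power_mult_distrib power2_norm_eq_inner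
      by (subst euclidean_inner) (simp add: power2_eq_square sum_distrib_left mult_ac)
    then show ?thesis
      by (simp add: prod_ennreal exp_sum sum_negf[symmetric])
  qed
  then show ?thesis
    using assms by (simp add: nn_integral_lborel_prod[where f="\<lambda>i t. exp (- (b * t)\<^sup>2)" for b]
      nn_integral_exp_square)
qed

lemma inner_orthonormal_sum:
  assumes "finite I" "orthonormal_family I a" "i \<in> I"
  shows "(\<Sum>j\<in>I. y j *\<^sub>R a j) \<bullet> a i = y i"
proof -
  have "(\<Sum>j\<in>I. y j *\<^sub>R a j) \<bullet> a i = (\<Sum>j\<in>I. if j = i then y j else 0)"
    unfolding inner_sum_left using assms by (intro sum.cong) (auto simp: orthonormal_family_def)
  then show ?thesis using assms by simp
qed

lemma inner_sum_orthonormal: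
  assumes "finite I" "orthonormal_family I a"
  shows "(\<Sum>i\<in>I. y i *\<^sub>R a i) \<bullet> (\<Sum>i\<in>I. z i *\<^sub>R a i) = (\<Sum>i\<in>I. y i * z i)"
  by (subst inner_sum_right) (simp add: inner_orthonormal_sum[OF assms] mult.commute)

lemma orthonormal_family_inj_on: "orthonormal_family I a \<Longrightarrow> inj_on a I"
  unfolding orthonormal_family_def inj_on_def by (metis zero_neq_one)

lemma orthonormal_family_independent:
  assumes "orthonormal_family I (a :: 'i \<Rightarrow> 'a::euclidean_space)"
  shows "independent (a ` I)"
proof (rule pairwise_orthogonal_independent)
  show "pairwise orthogonal (a ` I)"
    using assms by (auto simp: pairwise_def orthogonal_def orthonormal_family_def)
  show "0 \<notin> a ` I"
    using assms unfolding orthonormal_family_def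
    by (metis imageE inner_zero_left zero_neq_one)
qed

lemma card_orthonormal_basis:
  assumes "orthonormal_basis_of I (a :: 'i \<Rightarrow> 'a::euclidean_space) V"
  shows "card I = dim V"
proof -
  have "orthonormal_family I a" "span (a ` I) = V"
    using assms by (auto simp: orthonormal_basis_of_def)
  then show ?thesis
    by (metis card_image dim_span_eq_card_independent orthonormal_family_independent
        orthonormal_family_inj_on)
qed

lemma orthonormal_basis_sum:
  fixes a :: "'i \<Rightarrow> 'a::euclidean_space"
  assumes "finite I" "orthonormal_basis_of I a V" "x \<in> V"
  shows "(\<Sum>i\<in>I. (x \<bullet> a i) *\<^sub>R a i) = x"
proof -
  have o: "orthonormal_family I a" and sp: "span (a ` I) = V"
    using assms by (auto simp: orthonormal_basis_of_def)
  have "(\<Sum>v\<in>a ` I. (x \<bullet> v) *\<^sub>R v) = x"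
    using o assms sp
    by (intro orthonormal_basis_expand)
       (auto simp: pairwise_def orthogonal_def orthonormal_family_def norm_eq_sqrt_inner)
  then show ?thesis
    by (simp add: sum.reindex orthonormal_family_inj_on[OF o])
qed

lemma orthonormal_basis_in: "orthonormal_basis_of I a V \<Longrightarrow> (\<Sum>i\<in>I. y i *\<^sub>R a i) \<in> V"
  by (auto simp: orthonormal_basis_of_def intro!: span_sum span_scale intro: span_base)

lemma dim_orthogonal_comp:
  fixes V :: "'a::euclidean_space set"
  assumes "subspace V"
  shows "dim (V\<^sup>\<bottom>) + dim V = DIM('a)"
proof -
  have int: "V\<^sup>\<bottom> \<inter> V = {0}"
    using subspace_0[OF assms] subspace_0[OF subspace_orthogonal_comp]
    by (auto simp: orthogonal_comp_def orthogonal_def)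
  have sum: "{x + y |x y. x \<in> V\<^sup>\<bottom> \<and> y \<in> V} = UNIV"
    using subspace_sum_orthogonal_comp[OF assms] by (auto simp: set_plus_def set_eq_iff) (metis add.commute)
  show ?thesis
    using dim_sums_Int[OF subspace_orthogonal_comp assms, of V] unfolding int sum by simp
qed

text \<open>The push-forward of product Lebesgue measure under orthonormal coordinates of \<open>V\<^sup>\<bottom>\<close> and \<open>V\<close> is
  translation invariant, hence a multiple of Lebesgue measure. By Pythagoras the Gaussian factorises in
  these coordinates and has the same integral for both measures, so the multiple is 1.\<close>

lemma nn_integral_lborel_orthogonal_sum:
  fixes a :: "'i \<Rightarrow> 'a::euclidean_space" and v :: "'j \<Rightarrow> 'a"
  assumes V: "subspace V" and fin: "finite I" "finite J"
    and a: "orthonormal_basis_of I a (V\<^sup>\<bottom>)" and v: "orthonormal_basis_of J v V"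
    and f[measurable]: "f \<in> borel_measurable borel"
  shows "(\<integral>\<^sup>+x. f x \<partial>lborel) =
    (\<integral>\<^sup>+y. \<integral>\<^sup>+h. f ((\<Sum>i\<in>I. y i *\<^sub>R a i) + (\<Sum>j\<in>J. h j *\<^sub>R v j)) \<partial>lborel_on J \<partial>lborel_on I)"
proof -
  interpret I: product_sigma_finite "\<lambda>_::'i. lborel :: real measure" by standard
  interpret I: finite_product_sigma_finite "\<lambda>_::'i. lborel :: real measure" I by standard fact
  interpret J: product_sigma_finite "\<lambda>_::'j. lborel :: real measure" by standard
  interpret J: finite_product_sigma_finite "\<lambda>_::'j. lborel :: real measure" J by standard fact
  interpret IJ: pair_sigma_finite "lborel_on I" "lborel_on J" by standard
  have oa: "orthonormal_family I a" and ov: "orthonormal_family J v"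
    using a v by (auto simp: orthonormal_basis_of_def)
  define T where "T = (\<lambda>(y, h). (\<Sum>i\<in>I. y i *\<^sub>R a i) + (\<Sum>j\<in>J. h j *\<^sub>R v j))"
  have [measurable]: "T \<in> borel_measurable (lborel_on I \<Otimes>\<^sub>M lborel_on J)"
    unfolding T_def by measurable
  define \<mu> where "\<mu> = distr (lborel_on I \<Otimes>\<^sub>M lborel_on J) borel T"
  have \<mu>: "(\<integral>\<^sup>+x. F x \<partial>\<mu>) = (\<integral>\<^sup>+y. \<integral>\<^sup>+h. F (T (y, h)) \<partial>lborel_on J \<partial>lborel_on I)"
    if [measurable]: "F \<in> borel_measurable borel" for F
    unfolding \<mu>_def by (simp add: nn_integral_distr J.nn_integral_fst[symmetric])
  have inv: "(\<integral>\<^sup>+x. F (b + x) \<partial>\<mu>) = (\<integral>\<^sup>+x. F x \<partial>\<mu>)" if [measurable]: "F \<in> borel_measurable borel" for b F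
  proof -
    obtain b1 b2 where b: "b = b1 + b2" "b1 \<in> V\<^sup>\<bottom>" "b2 \<in> V"
      using subspace_sum_orthogonal_comp[OF V] by (metis UNIV_I add.commute set_plus_elim)
    have T: "T (\<lambda>i\<in>I. b1 \<bullet> a i + 1 * y i, \<lambda>j\<in>J. b2 \<bullet> v j + 1 * h j) = b + T (y, h)" for y h
      using orthonormal_basis_sum[OF fin(1) a b(2)] orthonormal_basis_sum[OF fin(2) v b(3)]
      by (simp add: T_def b scaleR_add_left sum.distrib)
    have "(\<integral>\<^sup>+x. F x \<partial>\<mu>) = (\<integral>\<^sup>+y. \<integral>\<^sup>+h. F (T (y, h)) \<partial>lborel_on J \<partial>lborel_on I)"
      by (rule \<mu>) measurable
    also have "\<dots> = (\<integral>\<^sup>+y. \<integral>\<^sup>+h. F (T (y, \<lambda>j\<in>J. b2 \<bullet> v j + 1 * h j)) \<partial>lborel_on J \<partial>lborel_on I)"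
      by (subst nn_integral_PiM_affine[where r=1 and c="\<lambda>j. b2 \<bullet> v j"]) (simp_all add: fin T_def)
    also have "\<dots> = (\<integral>\<^sup>+y. \<integral>\<^sup>+h. F (T (\<lambda>i\<in>I. b1 \<bullet> a i + 1 * y i, \<lambda>j\<in>J. b2 \<bullet> v j + 1 * h j))
        \<partial>lborel_on J \<partial>lborel_on I)"
      by (subst nn_integral_PiM_affine[where r=1 and c="\<lambda>i. b1 \<bullet> a i"]) (simp_all add: fin)
    also have "\<dots> = (\<integral>\<^sup>+x. F (b + x) \<partial>\<mu>)"
      by (subst \<mu>) (simp_all only: T, measurable)
    finally show ?thesis ..
  qed
  have gauss: "(\<integral>\<^sup>+x. ennreal (exp (- (norm x)\<^sup>2)) \<partial>\<mu>) = (\<integral>\<^sup>+x. ennreal (exp (- (norm (x::'a))\<^sup>2)) \<partial>lborel)"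
  proof -
    have "ennreal (exp (- (norm (T (y, h)))\<^sup>2)) =
      (\<Prod>i\<in>I. ennreal (exp (- (1 * y i)\<^sup>2))) * (\<Prod>j\<in>J. ennreal (exp (- (1 * h j)\<^sup>2)))" for y h
    proof -
      have "orthogonal (\<Sum>j\<in>J. h j *\<^sub>R v j) (\<Sum>i\<in>I. y i *\<^sub>R a i)"
        using orthonormal_basis_in[OF a] orthonormal_basis_in[OF v] by (auto simp: orthogonal_comp_def)
      then have "(norm (T (y, h)))\<^sup>2 = (\<Sum>i\<in>I. (y i)\<^sup>2) + (\<Sum>j\<in>J. (h j)\<^sup>2)"
        unfolding T_def prod.case power2_norm_eq_inner
        by (simp add: inner_add_left inner_add_right orthogonal_def
          inner_commute inner_sum_orthonormal[OF fin(1) oa] inner_sum_orthonormal[OF fin(2) ov]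
          power2_eq_square)
      then show ?thesis
        by (simp add: prod_ennreal fin ennreal_mult[symmetric] prod_nonneg exp_add exp_diff exp_minus exp_sum
            sum_negf[symmetric] prod_inversef field_simps)
    qed
    then have "(\<integral>\<^sup>+x. ennreal (exp (- (norm x)\<^sup>2)) \<partial>\<mu>) =
      (\<integral>\<^sup>+y. \<integral>\<^sup>+h. (\<Prod>i\<in>I. ennreal (exp (- (1 * y i)\<^sup>2))) * (\<Prod>j\<in>J. ennreal (exp (- (1 * h j)\<^sup>2)))
        \<partial>lborel_on J \<partial>lborel_on I)"
      by (subst \<mu>) simp_all
    also have "\<dots> = ennreal (sqrt pi) ^ card I * ennreal (sqrt pi) ^ card J"
      using nn_integral_exp_square[of 1]
      by (simp add: nn_integral_cmult nn_integral_multc fin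
        I.product_nn_integral_prod[where f="\<lambda>i t. ennreal (exp (- t\<^sup>2))"]
        J.product_nn_integral_prod[where f="\<lambda>i t. ennreal (exp (- t\<^sup>2))"])
    also have "\<dots> = ennreal (sqrt pi) ^ DIM('a)"
      using dim_orthogonal_comp[OF V]
      by (simp add: power_add[symmetric] card_orthonormal_basis[OF a] card_orthonormal_basis[OF v])
    also have "\<dots> = (\<integral>\<^sup>+x. ennreal (exp (- (norm (x::'a))\<^sup>2)) \<partial>lborel)"
      using nn_integral_exp_norm_square[of 1, where 'a='a] by simp
    finally show ?thesis .
  qed
  have g: "(\<integral>\<^sup>+x. ennreal (exp (- (norm (x::'a))\<^sup>2)) \<partial>lborel) = ennreal (sqrt pi ^ DIM('a))"
    using nn_integral_exp_norm_square[of 1, where 'a='a] by (simp add: ennreal_power)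
  have "ennreal (sqrt pi ^ DIM('a)) * (\<integral>\<^sup>+x. f x \<partial>\<mu>) = ennreal (sqrt pi ^ DIM('a)) * (\<integral>\<^sup>+x. f x \<partial>lborel)"
    using translation_invariant_proportional_lborel[of \<mu> f] inv gauss g f
    by (simp add: \<mu>_def mult.commute)
  then have "(\<integral>\<^sup>+x. f x \<partial>\<mu>) = (\<integral>\<^sup>+x. f x \<partial>lborel)"
    by (simp add: ennreal_mult_cancel_left)
  then show ?thesis
    by (simp add: \<mu> T_def)
qed

text \<open>The push-forward of Lebesgue measure under \<open>T\<close> is translation invariant, hence a multiple of Lebesgue
  measure. A lower bound \<open>B * norm x \<le> norm (T x)\<close> bounds the integral of the Gaussian and so
  makes the multiple finite.\<close>

lemma nn_integral_linear_inj_finite: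
  fixes T :: "'a::euclidean_space \<Rightarrow> 'a"
  assumes T: "linear T" "inj T" and f[measurable]: "f \<in> borel_measurable borel"
    and fin: "(\<integral>\<^sup>+x. f x \<partial>lborel) < \<infinity>"
  shows "(\<integral>\<^sup>+x. f (T x) \<partial>lborel) < \<infinity>"
proof -
  obtain B where B: "B > 0" "\<And>x. B * norm x \<le> norm (T x)"
    using linear_inj_bounded_below_pos[OF T] by blast
  have [measurable]: "T \<in> borel_measurable borel"
    using T(1) by (intro borel_measurable_continuous_onI linear_continuous_on linear_conv_bounded_linear[THEN iffD1])
  define \<mu> where "\<mu> = distr lborel borel T"
  have \<mu>: "(\<integral>\<^sup>+x. F x \<partial>\<mu>) = (\<integral>\<^sup>+x. F (T x) \<partial>lborel)"
    if [measurable]: "F \<in> borel_measurable borel" for F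
    unfolding \<mu>_def by (simp add: nn_integral_distr)
  have inv: "(\<integral>\<^sup>+x. F (b + x) \<partial>\<mu>) = (\<integral>\<^sup>+x. F x \<partial>\<mu>)" if [measurable]: "F \<in> borel_measurable borel" for b F
  proof -
    obtain c where "b = T c"
      using linear_injective_imp_surjective[OF T] by (metis surjD)
    then show ?thesis
      using nn_integral_lborel_translate_reflect[of "\<lambda>x. F (T x)" 1 c] by (simp add: \<mu> linear_add[OF T(1)])
  qed
  have "(\<integral>\<^sup>+x. ennreal (exp (- (norm x)\<^sup>2)) \<partial>\<mu>) \<le> (\<integral>\<^sup>+x. ennreal (exp (- (B * norm (x::'a))\<^sup>2)) \<partial>lborel)"
    unfolding \<mu>[of "\<lambda>x. ennreal (exp (- (norm x)\<^sup>2))", simplified]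
    using B by (intro nn_integral_mono ennreal_leI) (simp add: power_mono)
  also have "\<dots> < \<infinity>"
    using B by (simp add: nn_integral_exp_norm_square ennreal_power less_top[symmetric])
  finally have g: "(\<integral>\<^sup>+x. ennreal (exp (- (norm x)\<^sup>2)) \<partial>\<mu>) < \<infinity>" .
  have "(\<integral>\<^sup>+x. f x \<partial>\<mu>) * (\<integral>\<^sup>+x. ennreal (exp (- (norm (x::'a))\<^sup>2)) \<partial>lborel) =
      (\<integral>\<^sup>+x. f x \<partial>lborel) * (\<integral>\<^sup>+x. ennreal (exp (- (norm x)\<^sup>2)) \<partial>\<mu>)"
    using inv g by (intro translation_invariant_proportional_lborel) (auto simp: \<mu>_def)
  also have "\<dots> < \<infinity>"
    using fin g by (simp add: ennreal_mult_less_top)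
  finally have "(\<integral>\<^sup>+x. f x \<partial>\<mu>) < \<infinity>"
    using nn_integral_exp_norm_square[of 1, where 'a='a]
    by (auto simp: ennreal_mult_less_top ennreal_power)
  then show ?thesis
    by (simp add: \<mu>)
qed

section \<open>Absolute convergence of the Fourier integral\<close>

lemma exists_orthonormal_basis:
  fixes V :: "'a::euclidean_space set"
  assumes "subspace V"
  obtains v :: "nat \<Rightarrow> 'a" where "orthonormal_basis_of {..<dim V} v V"
proof -
  obtain B where B: "pairwise orthogonal B" "\<And>x. x \<in> B \<Longrightarrow> norm x = 1" "independent B"
      "card B = dim V" "span B = V"
    using orthonormal_basis_subspace[OF assms] by metis
  then obtain v where v: "bij_betw v {..<dim V} B"
    by (metis ex_bij_betw_nat_finite atLeast0LessThan independent_imp_finite)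
  have "orthonormal_family {..<dim V} v"
    unfolding orthonormal_family_def
  proof (intro ballI)
    fix i j assume ij: "i \<in> {..<dim V}" "j \<in> {..<dim V}"
    then have "v i \<in> B" "v j \<in> B" "v i = v j \<longleftrightarrow> i = j"
      using v by (auto simp: bij_betw_def inj_on_def)
    then show "v i \<bullet> v j = (if i = j then 1 else 0)"
      using B(1,2) by (auto simp: pairwise_def orthogonal_def norm_eq_1)
  qed
  moreover have "span (v ` {..<dim V}) = V"
    using v B(5) by (simp add: bij_betw_def)
  ultimately show ?thesis
    using that by (simp add: orthonormal_basis_of_def)
qed

definition determines :: "(real ^ 'd) set \<Rightarrow> 'd set \<Rightarrow> bool" where
  "determines W B \<longleftrightarrow> (\<forall>x\<in>W. (\<forall>j\<in>B. x $ j = 0) \<longrightarrow> x = 0)"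

text \<open>For a subspace \<open>W\<close>, the sets of least size that determine it are those for which the coordinate
  functionals form a basis of the dual space of \<open>W\<close>.\<close>

definition minimal_determining :: "(real ^ 'd) set \<Rightarrow> 'd set \<Rightarrow> bool" where
  "minimal_determining W B \<longleftrightarrow> determines W B \<and> (\<forall>C. determines W C \<longrightarrow> card B \<le> card C)"

text \<open>Dropping \<open>j\<close> from \<open>B\<close> leaves a set that is too small to determine \<open>W\<close>. The vectors obtained in
  this way form the basis of \<open>W\<close> that is dual to the coordinates in \<open>B\<close>.\<close>

lemma minimal_determining_dual_vector:
  fixes W :: "(real ^ 'd) set"
  assumes W: "subspace W" and B: "minimal_determining W B" and j: "j \<in> B"
  obtains x where "x \<in> W" "x $ j = 1" "\<And>i. i \<in> B - {j} \<Longrightarrow> x $ i = 0"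
proof -
  have "card (B - {j}) < card B"
    using j by (intro psubset_card_mono) auto
  then have "\<not> determines W (B - {j})"
    using B by (auto simp: minimal_determining_def not_le)
  then obtain y where y: "y \<in> W" "\<And>i. i \<in> B - {j} \<Longrightarrow> y $ i = 0" "y \<noteq> 0"
    by (auto simp: determines_def)
  have "y $ j \<noteq> 0"
    using B y unfolding minimal_determining_def determines_def by (metis Diff_iff singletonD)
  then show ?thesis
    using y W that[of "(1 / (y $ j)) *\<^sub>R y"] by (simp add: subspace_scale)
qed

text \<open>Basis exchange. The dual vector \<open>x\<close> of \<open>j\<close> is not an axis vector, so it has a further non-zero
  coordinate \<open>i\<close>. A vector of \<open>W\<close> that vanishes on \<open>B - {j}\<close> is a multiple of \<open>x\<close>, so the coordinate \<open>i\<close>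
  detects it as well as \<open>j\<close> does.\<close>

lemma minimal_determining_exchange:
  fixes W :: "(real ^ 'd) set"
  assumes W: "subspace W" and no_axis: "\<And>j. axis j 1 \<notin> W"
    and B: "minimal_determining W B" and j: "j \<in> B"
  obtains i where "i \<notin> B" "minimal_determining W (insert i (B - {j}))"
proof -
  obtain x where x: "x \<in> W" "x $ j = 1" "\<And>i. i \<in> B - {j} \<Longrightarrow> x $ i = 0"
    using minimal_determining_dual_vector[OF W B j] by blast
  have "\<exists>i. i \<noteq> j \<and> x $ i \<noteq> 0"
  proof (rule ccontr)
    assume "\<nexists>i. i \<noteq> j \<and> x $ i \<noteq> 0"
    then have "x $ i = axis j 1 $ i" for i
      using x(2) by (cases "i = j") (auto simp: axis_def)
    then have "x = axis j 1"
      by (simp add: vec_eq_iff)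
    with x(1) no_axis[of j] show False
      by metis
  qed
  then obtain i where i: "i \<noteq> j" "x $ i \<noteq> 0" by blast
  then have "i \<notin> B"
    using x(3)[of i] by auto
  have determines_W: "determines W B"
    using B by (simp add: minimal_determining_def)
  have determines_W': "determines W (insert i (B - {j}))"
    unfolding determines_def
  proof (intro ballI impI)
    fix y assume y: "y \<in> W" "\<forall>k\<in>insert i (B - {j}). y $ k = 0"
    have "y - (y $ j) *\<^sub>R x \<in> W"
      by (intro subspace_diff subspace_scale W x(1) y(1))
    moreover have "(y - (y $ j) *\<^sub>R x) $ k = 0" if "k \<in> B" for k
      using that x(2) x(3)[of k] y(2) by (cases "k = j") simp_all
    ultimately have "y - (y $ j) *\<^sub>R x = 0"
      using determines_W unfolding determines_def by blast
    then have "y = (y $ j) *\<^sub>R x"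
      by (rule right_minus_eq[THEN iffD1])
    then have "\<exists>c. y = c *\<^sub>R x"
      by (rule exI)
    then obtain c where c: "y = c *\<^sub>R x" ..
    then have "c * x $ i = 0"
      using y(2) by auto
    then show "y = 0"
      using i c by simp
  qed
  have "card (insert i (B - {j})) = Suc (card (B - {j}))"
    using \<open>i \<notin> B\<close> by (intro card_insert_disjoint) auto
  also have "Suc (card (B - {j})) = card B"
    using j by (intro card_Suc_Diff1) auto
  finally have "minimal_determining W (insert i (B - {j}))"
    using B determines_W' unfolding minimal_determining_def by simp
  with \<open>i \<notin> B\<close> show ?thesis
    by (rule that)
qed

lemma exists_minimal_determining: "\<exists>B. minimal_determining (W :: (real ^ 'd) set) B"
proof -
  have "determines W UNIV"
    by (auto simp: determines_def vec_eq_iff)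
  from ex_has_least_nat[of "determines W", OF this] show ?thesis
    by (auto simp: minimal_determining_def)
qed

text \<open>In a set of least total weight an exchange cannot lower the weight, so the replacement for \<open>j\<close>
  weighs at least as much as \<open>j\<close>.\<close>

lemma exists_lightest_minimal_determining:
  fixes W :: "(real ^ 'd) set" and w :: "'d \<Rightarrow> real"
  assumes W: "subspace W" and no_axis: "\<And>j. axis j 1 \<notin> W"
  obtains B where "minimal_determining W B" "\<And>j. j \<in> B \<Longrightarrow> \<exists>i. i \<notin> B \<and> w j \<le> w i"
proof -
  obtain B where B: "minimal_determining W B"
      "\<And>C. minimal_determining W C \<Longrightarrow> sum w B \<le> sum w C"
    using ex_is_arg_min_if_finite[of "Collect (minimal_determining W)" "sum w"]
      exists_minimal_determining[of W]
    by (auto simp: is_arg_min_linorder)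
  show ?thesis
  proof (rule that[OF B(1)])
    fix j assume j: "j \<in> B"
    obtain i where i: "i \<notin> B" "minimal_determining W (insert i (B - {j}))"
      using minimal_determining_exchange[OF W no_axis B(1) j] by blast
    have "sum w B \<le> w i + sum w (B - {j})"
      using B(2)[OF i(2)] i(1) by simp
    then have "w j \<le> w i"
      using j by (simp add: sum.remove[of B j])
    then show "\<exists>i. i \<notin> B \<and> w j \<le> w i"
      using i(1) by blast
  qed
qed

text \<open>This bound is what makes the Fourier integral absolutely convergent: the factors with index in a set
  \<open>B\<close> of independent coordinates decay with exponent 1 only, which just fails to be integrable, and the
  remaining factors must supply the missing decay. Choose \<open>B\<close> lightest for the weights \<open>\<bar>x $ j\<bar>\<close>. Then
  some factor outside \<open>B\<close> is at most as large as each factor in \<open>B\<close>, and splitting it into \<open>CARD('d)\<close> equal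
  powers raises every exponent in \<open>B\<close> by \<open>1 / CARD('d)\<close>. The set \<open>B\<close> depends on \<open>x\<close>, whence the sum over
  all candidates.\<close>

lemma prod_inverse_le_sum_minimal_determining:
  fixes W :: "(real ^ 'd) set"
  assumes W: "subspace W" and no_axis: "\<And>j. axis j 1 \<notin> W"
  shows "(\<Prod>j\<in>UNIV. (1 + \<bar>x $ j\<bar>) powr -1) \<le>
    (\<Sum>B | minimal_determining W B. \<Prod>j\<in>B. (1 + \<bar>x $ j\<bar>) powr - (1 + 1 / CARD('d)))"
proof -
  define q where "q j = (1 + \<bar>x $ j\<bar>) powr -1" for j
  define \<delta> where "\<delta> = 1 / real CARD('d)"
  have \<delta>: "\<delta> > 0" "real CARD('d) * \<delta> = 1" by (simp_all add: \<delta>_def)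
  have q: "0 < q j" "q j \<le> 1" for j
    using powr_mono2'[of "-1" 1 "1 + \<bar>x $ j\<bar>"] by (auto simp: q_def)
  obtain B where B: "minimal_determining W B" "\<And>j. j \<in> B \<Longrightarrow> \<exists>i. i \<notin> B \<and> \<bar>x $ j\<bar> \<le> \<bar>x $ i\<bar>"
    using exists_lightest_minimal_determining[OF W no_axis, of "\<lambda>j. \<bar>x $ j\<bar>"] by blast
  have out: "prod q (- B) \<le> (\<Prod>j\<in>B. q j powr \<delta>)"
  proof (cases "B = {}")
    case True
    then show ?thesis using q by (simp add: prod_le_1 less_imp_le)
  next
    case False
    then have "- B \<noteq> {}" using B(2) by blast
    then obtain i where i: "i \<in> - B" "\<And>k. k \<in> - B \<Longrightarrow> q i \<le> q k"
      using ex_is_arg_min_if_finite[of "- B" q] by (auto simp: is_arg_min_linorder)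
    have le: "q i \<le> q j" if j: "j \<in> B" for j
    proof -
      obtain k where "k \<in> - B" "\<bar>x $ j\<bar> \<le> \<bar>x $ k\<bar>" using B(2)[OF j] by auto
      then have "q k \<le> q j" by (simp add: q_def frac_le)
      then show ?thesis using i(2)[OF \<open>k \<in> - B\<close>] by simp
    qed
    have "prod q (- B) = q i * prod q (- B - {i})"
      using i(1) by (simp add: prod.remove)
    also have "\<dots> \<le> q i * 1"
      using q by (intro mult_left_mono prod_le_1) (simp_all add: less_imp_le)
    (* split the smallest outside factor into CARD('d) equal powers, which suffice for all elements of B *)
    also have "\<dots> = (q i powr \<delta>) ^ CARD('d)"
      using q[of i] \<delta> by (simp add: powr_realpow[symmetric] powr_powr mult.commute)
    also have "\<dots> \<le> (q i powr \<delta>) ^ card B"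
      using q[of i] \<delta>(1) by (intro power_decreasing) (simp_all add: card_mono powr_le1 less_imp_le)
    also have "\<dots> = (\<Prod>j\<in>B. q i powr \<delta>)" by simp
    also have "\<dots> \<le> (\<Prod>j\<in>B. q j powr \<delta>)"
      using le q \<delta>(1) by (intro prod_mono) (simp_all add: powr_mono2 less_imp_le)
    finally show ?thesis .
  qed
  have "prod q UNIV = prod q B * prod q (- B)"
    by (subst prod.union_disjoint[symmetric]) (auto simp: Un_commute)
  also have "\<dots> \<le> prod q B * (\<Prod>j\<in>B. q j powr \<delta>)"
    using q out by (intro mult_left_mono prod_nonneg) (simp_all add: less_imp_le)
  also have "\<dots> = (\<Prod>j\<in>B. (1 + \<bar>x $ j\<bar>) powr - (1 + \<delta>))"
  proof -
    have "q j * q j powr \<delta> = (1 + \<bar>x $ j\<bar>) powr (- 1 + - 1 * \<delta>)" for j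
      unfolding q_def powr_powr powr_add ..
    moreover have "- 1 + - 1 * \<delta> = - (1 + \<delta>)" by simp
    ultimately show ?thesis by (simp only: prod.distrib[symmetric])
  qed
  also have "\<dots> \<le> (\<Sum>B | minimal_determining W B. \<Prod>j\<in>B. (1 + \<bar>x $ j\<bar>) powr - (1 + \<delta>))"
    using B(1) by (intro member_le_sum) (auto intro: prod_nonneg)
  finally show ?thesis by (simp add: q_def \<delta>_def)
qed

lemma nn_integral_one_plus_abs_powr_finite:
  assumes "\<delta> > 0"
  shows "(\<integral>\<^sup>+t. ennreal ((1 + \<bar>t\<bar>) powr - (1 + \<delta>)) \<partial>lborel) < \<infinity>"
proof -
  let ?f = "\<lambda>t::real. (1 + \<bar>t\<bar>) powr - (1 + \<delta>)"
  let ?F = "\<lambda>t::real. - ((1 + t) powr - \<delta>) / \<delta>"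
  have half: "(\<integral>\<^sup>+t. ennreal (?f t) * indicator {0..} t \<partial>lborel) = ennreal (0 - ?F 0)"
  proof -
    have "(\<integral>\<^sup>+t. ennreal (?f t) * indicator {0..} t \<partial>lborel) =
      (\<integral>\<^sup>+t. ennreal ((1 + t) powr - (1 + \<delta>)) * indicator {0..} t \<partial>lborel)"
      by (intro nn_integral_cong) (auto simp: indicator_def)
    also have "\<dots> = ennreal (0 - ?F 0)"
    proof (rule nn_integral_FTC_atLeast)
      fix t :: real assume "0 \<le> t"
      then have "DERIV (\<lambda>t. (1 + t) powr - \<delta>) t :> - \<delta> * (1 + t) powr (- \<delta> - of_nat 1) * 1"
        by (intro DERIV_fun_powr) (auto intro!: derivative_eq_intros)
      moreover have "- (- \<delta> * (1 + t) powr (- \<delta> - of_nat 1) * 1) / \<delta> = (1 + t) powr - (1 + \<delta>)"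
        using assms by (simp add: minus_diff_commute)
      ultimately show "DERIV ?F t :> (1 + t) powr - (1 + \<delta>)"
        using DERIV_cdivide[OF DERIV_minus] by metis
    next
      show "(?F \<longlongrightarrow> 0) at_top"
        using assms by real_asymp
    qed auto
    finally show ?thesis .
  qed
  have "(\<integral>\<^sup>+t. ennreal (?f t) \<partial>lborel) \<le>
      (\<integral>\<^sup>+t. ennreal (?f t) * indicator {0..} t + ennreal (?f (- t)) * indicator {0..} (- t) \<partial>lborel)"
    by (intro nn_integral_mono) (auto simp: indicator_def)
  also have "\<dots> = (\<integral>\<^sup>+t. ennreal (?f t) * indicator {0..} t \<partial>lborel) +
      (\<integral>\<^sup>+t. ennreal (?f (- t)) * indicator {0..} (- t) \<partial>lborel)"
    by (intro nn_integral_add) auto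
  also have "(\<integral>\<^sup>+t. ennreal (?f (- t)) * indicator {0..} (- t) \<partial>lborel) =
      (\<integral>\<^sup>+t. ennreal (?f t) * indicator {0..} t \<partial>lborel)"
    using nn_integral_lborel_translate_reflect[of "\<lambda>t. ennreal (?f t) * indicator {0..} t" "-1" 0] by simp
  finally show ?thesis
    unfolding half by (rule order_le_less_trans) (simp add: less_top)
qed

lemma Basis_vec_real: "(Basis :: (real ^ 'd) set) = range (\<lambda>j. axis j 1)"
  by (auto simp: Basis_vec_def)

lemma nn_integral_lborel_prod_vec:
  assumes [measurable]: "\<And>j. f j \<in> borel_measurable borel" and nn: "\<And>j t. 0 \<le> f j t"
  shows "(\<integral>\<^sup>+x. ennreal (\<Prod>j\<in>UNIV. f j (x $ j)) \<partial>(lborel :: (real ^ 'd) measure)) =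
    (\<Prod>j\<in>UNIV. \<integral>\<^sup>+t. ennreal (f j t) \<partial>lborel)"
proof -
  have inj: "inj (\<lambda>j::'d. axis j (1::real))"
    by (auto simp: inj_on_def axis_eq_axis)
  define g where "g b = f (inv (\<lambda>j::'d. axis j (1::real)) b)" for b
  have g: "g (axis j 1) = f j" for j
    by (simp add: g_def inv_f_f[OF inj])
  have "(\<integral>\<^sup>+x. ennreal (\<Prod>j\<in>UNIV. f j (x $ j)) \<partial>(lborel :: (real ^ 'd) measure)) =
      (\<integral>\<^sup>+x. ennreal (\<Prod>b\<in>Basis. g b (x \<bullet> b)) \<partial>(lborel :: (real ^ 'd) measure))"
    unfolding Basis_vec_real prod.reindex[OF inj] comp_def g inner_axis by simp
  also have "\<dots> = (\<Prod>b\<in>Basis. \<integral>\<^sup>+t. ennreal (g b t) \<partial>lborel)"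
    by (subst prod_ennreal[symmetric], use nn in \<open>simp add: g_def\<close>)
      (rule nn_integral_lborel_prod, use nn in \<open>simp_all add: g_def\<close>)
  also have "\<dots> = (\<Prod>j\<in>UNIV. \<integral>\<^sup>+t. ennreal (f j t) \<partial>lborel)"
    unfolding Basis_vec_real prod.reindex[OF inj] comp_def g ..
  finally show ?thesis .
qed

lemma emeasure_space_lborel_on: "finite I \<Longrightarrow> emeasure (lborel_on I) (space (lborel_on I)) \<noteq> 0"
proof -
  assume I: "finite I"
  interpret product_sigma_finite "\<lambda>_. lborel :: real measure" by standard
  show ?thesis
    using emeasure_PiM[of I "\<lambda>_. UNIV"] I by (simp add: space_PiM)
qed

text \<open>The coordinates in \<open>B\<close> of the component in \<open>V\<^sup>\<bottom>\<close> and the coordinates outside \<open>B\<close> of the component in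
  \<open>V\<close> together form a linear endomorphism \<open>T\<close> of the whole space. It is injective: \<open>B\<close> determines the first
  component, and an element of \<open>V\<close> that is supported on \<open>B\<close> vanishes because it is orthogonal to the dual
  vectors. So the product of \<open>\<psi> (T x $ j)\<close> over all \<open>j\<close> has a finite integral over the whole space. This
  integral is the product of the one in question and of an integral over \<open>V\<close>, which is positive.\<close>

lemma nn_integral_minimal_determining_finite:
  fixes V :: "(real ^ 'd) set"
  assumes V: "subspace V" and I: "finite I" and a: "orthonormal_basis_of I a (V\<^sup>\<bottom>)"
    and B: "minimal_determining (V\<^sup>\<bottom>) B" and \<delta>: "\<delta> > 0"
  shows "(\<integral>\<^sup>+s. ennreal (\<Prod>j\<in>B. (1 + \<bar>(\<Sum>i\<in>I. s i *\<^sub>R a i) $ j\<bar>) powr - (1 + \<delta>)) \<partial>lborel_on I) < \<infinity>"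
proof -
  obtain v :: "nat \<Rightarrow> _" where v: "orthonormal_basis_of {..<dim V} v V"
    using exists_orthonormal_basis[OF V] .
  let ?J = "{..<dim V}"
  have oa: "orthonormal_family I a" using a by (simp add: orthonormal_basis_of_def)
  define \<psi> where "\<psi> = (\<lambda>t::real. (1 + \<bar>t\<bar>) powr - (1 + \<delta>))"
  have [measurable]: "\<psi> \<in> borel_measurable borel" unfolding \<psi>_def by measurable
  have \<psi>: "0 < \<psi> t" for t by (auto simp: \<psi>_def)
  define P where "P x = (\<Sum>i\<in>I. (x \<bullet> a i) *\<^sub>R a i)" for x
  have linP: "linear P"
    unfolding P_def
    by (intro linearI) (simp_all add: inner_add_left scaleR_add_left sum.distrib scaleR_sum_right)
  have P_in: "P x \<in> V\<^sup>\<bottom>" for x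
    unfolding P_def by (rule orthonormal_basis_in[OF a])
  have P_fix: "P x = x" if "x \<in> V\<^sup>\<bottom>" for x
    unfolding P_def by (rule orthonormal_basis_sum[OF I a that])
  have P_zero: "P x = 0" if "x \<in> V" for x
  proof -
    have "a i \<in> V\<^sup>\<bottom>" if "i \<in> I" for i
      using a that by (auto simp: orthonormal_basis_of_def intro: span_base)
    then show ?thesis
      using that by (auto simp: P_def orthogonal_comp_def orthogonal_def intro!: sum.neutral)
  qed
  have Q_in: "x - P x \<in> V" for x
  proof -
    have "x - P x \<in> V\<^sup>\<bottom>\<^sup>\<bottom>"
      unfolding orthogonal_comp_def[of "V\<^sup>\<bottom>"]
    proof (intro CollectI ballI)
      fix y assume y: "y \<in> V\<^sup>\<bottom>"
      have "y \<bullet> P x = x \<bullet> P y"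
        by (simp add: P_def inner_sum_right mult.commute)
      then show "orthogonal y (x - P x)"
        using P_fix[OF y] by (simp add: orthogonal_def inner_diff_right inner_commute)
    qed
    then show ?thesis by (simp add: orthogonal_comp_self V)
  qed
  define T where "T x = (\<chi> j. if j \<in> B then P x $ j else (x - P x) $ j)" for x
  have linT: "linear T"
    using linP by (intro linearI) (auto simp: T_def vec_eq_iff linear_add linear_scale algebra_simps)
  have "inj T"
  proof (subst linear_injective_0[OF linT], intro allI impI)
    fix x assume "T x = 0"
    then have T0: "T x $ j = 0" for j by simp
    have 0: "P x $ j = 0" if "j \<in> B" for j
      using T0[of j] that by (simp add: T_def)
    have 1: "(x - P x) $ j = 0" if "j \<notin> B" for j
      using T0[of j] that by (simp add: T_def)
    have Px: "P x = 0"
      using B P_in 0 by (auto simp: minimal_determining_def determines_def)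
    have "x $ j = 0" for j
    proof (cases "j \<in> B")
      case False
      then show ?thesis using 1 Px by simp
    next
      case True
      obtain y where y: "y \<in> V\<^sup>\<bottom>" "y $ j = 1" "\<And>i. i \<in> B - {j} \<Longrightarrow> y $ i = 0"
        using minimal_determining_dual_vector[OF subspace_orthogonal_comp B True] by blast
      have "x \<bullet> y = 0"
        using Q_in[of x] Px y(1) by (auto simp: orthogonal_comp_def orthogonal_def)
      moreover have "x \<bullet> y = (\<Sum>i\<in>UNIV. if i = j then x $ j else 0)"
        unfolding inner_vec_def using 1 Px y by (intro sum.cong) auto
      ultimately show ?thesis by simp
    qed
    then show "x = 0" by (simp add: vec_eq_iff)
  qed
  let ?X = "\<integral>\<^sup>+s. ennreal (\<Prod>j\<in>B. \<psi> ((\<Sum>i\<in>I. s i *\<^sub>R a i) $ j)) \<partial>lborel_on I"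
  let ?Y = "\<integral>\<^sup>+h. ennreal (\<Prod>j\<in>-B. \<psi> ((\<Sum>i\<in>?J. h i *\<^sub>R v i) $ j)) \<partial>lborel_on ?J"
  have "(\<integral>\<^sup>+x. ennreal (\<Prod>j\<in>UNIV. \<psi> (x $ j)) \<partial>(lborel :: (real ^ 'd) measure)) < \<infinity>"
    using \<psi> nn_integral_one_plus_abs_powr_finite[OF \<delta>]
    by (subst nn_integral_lborel_prod_vec) (simp_all add: less_imp_le \<psi>_def power_less_top_ennreal)
  then have fin: "(\<integral>\<^sup>+x. ennreal (\<Prod>j\<in>UNIV. \<psi> (T x $ j)) \<partial>lborel) < \<infinity>"
    by (intro nn_integral_linear_inj_finite[OF linT \<open>inj T\<close>, of "\<lambda>x. ennreal (\<Prod>j\<in>UNIV. \<psi> (x $ j))"]) auto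
  (* T separates the two components, so the product over all coordinates splits *)
  have T_sum: "(\<Prod>j\<in>UNIV. \<psi> (T (y + z) $ j)) = (\<Prod>j\<in>B. \<psi> (y $ j)) * (\<Prod>j\<in>-B. \<psi> (z $ j))"
    if "y \<in> V\<^sup>\<bottom>" "z \<in> V" for y z
  proof -
    have "P (y + z) = y"
      using that by (simp add: linear_add[OF linP] P_fix P_zero)
    then have "(\<Prod>j\<in>B. \<psi> (T (y + z) $ j)) = (\<Prod>j\<in>B. \<psi> (y $ j))"
        "(\<Prod>j\<in>-B. \<psi> (T (y + z) $ j)) = (\<Prod>j\<in>-B. \<psi> (z $ j))"
      by (auto simp: T_def intro!: prod.cong)
    moreover have "(\<Prod>j\<in>UNIV. \<psi> (T (y + z) $ j)) = (\<Prod>j\<in>B. \<psi> (T (y + z) $ j)) * (\<Prod>j\<in>-B. \<psi> (T (y + z) $ j))"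
      by (subst prod.union_disjoint[symmetric]) (auto simp: Un_commute)
    ultimately show ?thesis by simp
  qed
  have [measurable]: "T \<in> borel_measurable borel"
    using linT by (intro borel_measurable_continuous_onI linear_continuous_on linear_conv_bounded_linear[THEN iffD1])
  have [measurable]: "(\<lambda>x. T x $ j) \<in> borel_measurable borel" for j
    by (rule measurable_compose[OF _ borel_measurable_nth]) measurable
  have "(\<integral>\<^sup>+x. ennreal (\<Prod>j\<in>UNIV. \<psi> (T x $ j)) \<partial>lborel) =
      (\<integral>\<^sup>+s. \<integral>\<^sup>+h. ennreal (\<Prod>j\<in>B. \<psi> ((\<Sum>i\<in>I. s i *\<^sub>R a i) $ j)) *
        ennreal (\<Prod>j\<in>-B. \<psi> ((\<Sum>i\<in>?J. h i *\<^sub>R v i) $ j)) \<partial>lborel_on ?J \<partial>lborel_on I)"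
    using \<psi> by (subst nn_integral_lborel_orthogonal_sum[OF V I _ a v])
      (simp_all add: T_sum orthonormal_basis_in[OF a] orthonormal_basis_in[OF v] ennreal_mult prod_nonneg less_imp_le)
  also have "\<dots> = ?X * ?Y"
    by (simp add: nn_integral_cmult nn_integral_multc)
  finally have XY: "?X * ?Y < \<infinity>" using fin by simp
  have "?Y \<noteq> 0"
  proof
    assume "?Y = 0"
    then have "AE h in lborel_on ?J. ennreal (\<Prod>j\<in>-B. \<psi> ((\<Sum>i\<in>?J. h i *\<^sub>R v i) $ j)) = 0"
      by (subst (asm) nn_integral_0_iff_AE) simp_all
    moreover have "ennreal (\<Prod>j\<in>-B. \<psi> ((\<Sum>i\<in>?J. h i *\<^sub>R v i) $ j)) \<noteq> 0" for h :: "nat \<Rightarrow> real"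
      using \<psi> by (simp only: ennreal_eq_0_iff not_le) (intro prod_pos, simp)
    ultimately have "AE h in lborel_on ?J. False"
      by (simp only:)
    then show False
      using emeasure_space_lborel_on[of ?J] by (simp add: AE_iff_measurable[OF _ refl])
  qed
  then have "?X < \<infinity>" using XY by (auto simp: ennreal_mult_less_top)
  then show ?thesis by (simp add: \<psi>_def)
qed

lemma integrable_prod_inverse_linear_form:
  fixes V :: "(real ^ 'd) set"
  assumes V: "subspace V" and I: "finite I" and a: "orthonormal_basis_of I a (V\<^sup>\<bottom>)"
    and nondegenerate: "\<And>j. \<not> V \<subseteq> {x. x $ j = 0}"
  shows "integrable (lborel_on I)
    (\<lambda>s. \<Prod>j\<in>UNIV. 1 / (1 + \<i> * complex_of_real (\<Sum>i\<in>I. a i $ j * s i)))"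
proof (rule integrableI_bounded)
  show "(\<lambda>s. \<Prod>j\<in>UNIV. 1 / (1 + \<i> * complex_of_real (\<Sum>i\<in>I. a i $ j * s i)))
      \<in> borel_measurable (lborel_on I)" by measurable
  define x where "x s = (\<Sum>i\<in>I. s i *\<^sub>R a i)" for s :: "_ \<Rightarrow> real"
  let ?N = "CARD('d)"
  let ?\<B> = "{B. minimal_determining (V\<^sup>\<bottom>) B}"
  have no_axis: "axis j 1 \<notin> V\<^sup>\<bottom>" for j
    using nondegenerate[of j] by (auto simp: orthogonal_comp_def orthogonal_def inner_axis)
  have "norm (\<Prod>j\<in>UNIV. 1 / (1 + \<i> * complex_of_real (\<Sum>i\<in>I. a i $ j * s i))) \<le>
      2 ^ ?N * (\<Sum>B\<in>?\<B>. \<Prod>j\<in>B. (1 + \<bar>x s $ j\<bar>) powr - (1 + 1 / ?N))" for s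
  proof -
    have le: "norm (1 / (1 + \<i> * complex_of_real t)) \<le> 2 * (1 + \<bar>t\<bar>) powr -1" for t
    proof -
      have "1 + \<bar>t\<bar> \<le> 2 * cmod (1 + \<i> * complex_of_real t)"
        using abs_Re_le_cmod[of "1 + \<i> * complex_of_real t"] abs_Im_le_cmod[of "1 + \<i> * complex_of_real t"]
        by simp
      moreover have "0 < 1 + \<bar>t\<bar>" by linarith
      ultimately show ?thesis
        by (simp add: norm_divide powr_minus_divide divide_simps)
    qed
    have "norm (\<Prod>j\<in>UNIV. 1 / (1 + \<i> * complex_of_real (\<Sum>i\<in>I. a i $ j * s i))) \<le>
        (\<Prod>j\<in>UNIV. 2 * (1 + \<bar>\<Sum>i\<in>I. a i $ j * s i\<bar>) powr -1)"
      unfolding prod_norm[symmetric] by (intro prod_mono conjI norm_ge_zero le)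
    also have "\<dots> = 2 ^ ?N * (\<Prod>j\<in>UNIV. (1 + \<bar>x s $ j\<bar>) powr -1)"
      by (simp only: prod.distrib prod_constant x_def sum_component vector_scaleR_component
          real_scaleR_def mult.commute)
    also have "\<dots> \<le> 2 ^ ?N * (\<Sum>B\<in>?\<B>. \<Prod>j\<in>B. (1 + \<bar>x s $ j\<bar>) powr - (1 + 1 / ?N))"
      by (intro mult_left_mono prod_inverse_le_sum_minimal_determining subspace_orthogonal_comp no_axis) auto
    finally show ?thesis .
  qed
  then have "(\<integral>\<^sup>+s. ennreal (norm (\<Prod>j\<in>UNIV. 1 / (1 + \<i> * complex_of_real (\<Sum>i\<in>I. a i $ j * s i)))) \<partial>lborel_on I)
      \<le> (\<integral>\<^sup>+s. ennreal (2 ^ ?N * (\<Sum>B\<in>?\<B>. \<Prod>j\<in>B. (1 + \<bar>x s $ j\<bar>) powr - (1 + 1 / ?N))) \<partial>lborel_on I)"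
    by (intro nn_integral_mono ennreal_leI)
  also have "\<dots> = (\<integral>\<^sup>+s. ennreal (2 ^ ?N) *
      (\<Sum>B\<in>?\<B>. ennreal (\<Prod>j\<in>B. (1 + \<bar>x s $ j\<bar>) powr - (1 + 1 / ?N))) \<partial>lborel_on I)"
    by (intro nn_integral_cong, subst ennreal_mult) (simp_all add: sum_nonneg prod_nonneg)
  also have "\<dots> = ennreal (2 ^ ?N) * (\<Sum>B\<in>?\<B>.
      \<integral>\<^sup>+s. ennreal (\<Prod>j\<in>B. (1 + \<bar>x s $ j\<bar>) powr - (1 + 1 / ?N)) \<partial>lborel_on I)"
    by (simp add: nn_integral_cmult nn_integral_sum x_def del: sum_ennreal)
  also have "\<dots> < \<infinity>"
    using nn_integral_minimal_determining_finite[OF V I a, of _ "1 / ?N"]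
    by (auto simp: x_def ennreal_mult_less_top)
  finally show "(\<integral>\<^sup>+s. ennreal (norm (\<Prod>j\<in>UNIV. 1 / (1 + \<i> * complex_of_real (\<Sum>i\<in>I. a i $ j * s i)))) \<partial>lborel_on I)
      < \<infinity>" .
qed

section \<open>Fourier transforms and Gaussian regularisation\<close>

lemma gaussian_fourier_transform:
  assumes "\<epsilon> > 0"
  shows "integrable lborel (\<lambda>t. complex_of_real (exp (- (\<epsilon> * t)\<^sup>2 / 2)) * iexp (- (t * y)))" (is ?int)
    and "(CLBINT t. complex_of_real (exp (- (\<epsilon> * t)\<^sup>2 / 2)) * iexp (- (t * y))) =
      complex_of_real (sqrt (2 * pi) / \<epsilon> * exp (- (y / \<epsilon>)\<^sup>2 / 2))" (is ?val)
proof -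
  have "(\<integral>\<^sup>+t. ennreal (exp (- (\<epsilon> * t)\<^sup>2 / 2)) \<partial>lborel) =
      (\<integral>\<^sup>+t. ennreal (exp (- (\<epsilon> / sqrt 2 * t)\<^sup>2)) \<partial>lborel)"
    by (simp add: power_mult_distrib power_divide)
  also have "\<dots> < \<infinity>"
    using assms by (subst nn_integral_exp_square) auto
  finally show ?int
    by (intro integrableI_bounded) (auto simp: norm_mult)
  have "char std_normal_distribution (- y / \<epsilon>) = complex_of_real (exp (- (y / \<epsilon>)\<^sup>2 / 2))"
    unfolding char_std_normal_distribution by (simp add: power_divide)
  then have "complex_of_real (exp (- (y / \<epsilon>)\<^sup>2 / 2)) =
      (CLBINT x. std_normal_density x *\<^sub>R iexp (- y / \<epsilon> * x))"
    unfolding char_def by (subst (asm) integral_density) auto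
  also have "\<dots> = \<epsilon> *\<^sub>R (CLBINT t. std_normal_density (\<epsilon> * t) *\<^sub>R iexp (- y / \<epsilon> * (\<epsilon> * t)))"
    using lborel_integral_real_affine[of \<epsilon> "\<lambda>x. std_normal_density x *\<^sub>R iexp (- y / \<epsilon> * x)" 0] assms
    by simp
  also have "(\<lambda>t. std_normal_density (\<epsilon> * t) *\<^sub>R iexp (- y / \<epsilon> * (\<epsilon> * t))) =
      (\<lambda>t. complex_of_real (1 / sqrt (2 * pi)) *
        (complex_of_real (exp (- (\<epsilon> * t)\<^sup>2 / 2)) * iexp (- (t * y))))"
    using assms by (auto simp: std_normal_density_def scaleR_conv_of_real fun_eq_iff mult.commute)
  also have "(CLBINT t. complex_of_real (1 / sqrt (2 * pi)) *
        (complex_of_real (exp (- (\<epsilon> * t)\<^sup>2 / 2)) * iexp (- (t * y)))) =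
      complex_of_real (1 / sqrt (2 * pi)) *
        (CLBINT t. complex_of_real (exp (- (\<epsilon> * t)\<^sup>2 / 2)) * iexp (- (t * y)))"
    by (rule integral_mult_right_zero)
  finally show ?val
    using assms by (simp add: scaleR_conv_of_real field_simps)
qed

lemma exponential_fourier_transform:
  shows "integrable lborel (\<lambda>x. complex_of_real (indicator {0..} x * exp (- x)) * iexp (- (x * t)))" (is ?int)
    and "(CLBINT x. complex_of_real (indicator {0..} x * exp (- x)) * iexp (- (x * t))) =
      1 / (1 + \<i> * complex_of_real t)" (is ?val)
proof -
  define c where "c = 1 + \<i> * complex_of_real t"
  have c0: "c \<noteq> 0"
    by (auto simp: c_def complex_eq_iff)
  have eq: "complex_of_real (exp (- x)) * iexp (- (x * t)) = exp (- (c * of_real x))" for x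
    by (simp add: c_def exp_of_real[symmetric] exp_add[symmetric] algebra_simps)
  have real: "integrable lborel (\<lambda>x. indicator {0..} x * exp (- x) :: real)"
    using has_bochner_integral_I0i_power_exp_m'[of 0] by (simp add: has_bochner_integral_iff mult.commute)
  show int: ?int
    by (rule Bochner_Integration.integrable_bound[OF real]) (auto simp: norm_mult)
  have "(LBINT x=0..\<infinity>. exp (- (c * of_real x))) = 0 - (- exp 0 / c)"
  proof (rule interval_integral_FTC_integrable[where F = "\<lambda>x. - exp (- (c * of_real x)) / c"])
    show "((\<lambda>x. - exp (- (c * complex_of_real x)) / c) has_vector_derivative exp (- (c * of_real x))) (at x)" for x
      using c0 by (intro has_vector_derivative_real_field) (auto intro!: derivative_eq_intros)
    show "isCont (\<lambda>x. exp (- (c * complex_of_real x))) x" for x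
      by (intro continuous_intros)
    show "set_integrable lborel (einterval 0 \<infinity>) (\<lambda>x. exp (- (c * complex_of_real x)))"
      unfolding set_integrable_def
      by (rule Bochner_Integration.integrable_bound[OF real])
        (auto simp: c_def indicator_def zero_ereal_def)
    show "(((\<lambda>x. - exp (- (c * complex_of_real x)) / c) \<circ> real_of_ereal) \<longlongrightarrow> - exp 0 / c) (at_right 0)"
      unfolding zero_ereal_def
      by (subst ereal_tendsto_simps) (auto intro!: tendsto_eq_intros simp: c0)
    show "(((\<lambda>x. - exp (- (c * complex_of_real x)) / c) \<circ> real_of_ereal) \<longlongrightarrow> 0) (at_left \<infinity>)"
    proof (subst ereal_tendsto_simps, rule tendsto_norm_zero_cancel)
      have "((\<lambda>x::real. exp (- x) / norm c) \<longlongrightarrow> 0) at_top"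
        by (rule tendsto_divide_zero) (rule filterlim_compose[OF exp_at_bot filterlim_uminus_at_bot_at_top])
      then show "((\<lambda>x. norm (- exp (- (c * complex_of_real x)) / c)) \<longlongrightarrow> 0) at_top"
        by (simp add: norm_divide c_def)
    qed
  qed simp
  also have "(LBINT x=0..\<infinity>. exp (- (c * of_real x))) =
      (CLBINT x. complex_of_real (indicator {0..} x * exp (- x)) * iexp (- (x * t)))"
    unfolding interval_lebesgue_integral_0_infty set_lebesgue_integral_def
  proof (rule integral_cong_AE)
    show "AE x in lborel. indicat_real {0<..} x *\<^sub>R exp (- (c * complex_of_real x)) =
        complex_of_real (indicator {0..} x * exp (- x)) * iexp (- (x * t))"
      using AE_lborel_singleton[of "0::real"]
      by eventually_elim (auto simp: indicator_def eq[symmetric])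
  qed measurable
  finally show ?val
    by (simp add: c_def)
qed

text \<open>The joint density of independent standard exponential random variables.\<close>

definition cone_density :: "real ^ 'd \<Rightarrow> real" where
  "cone_density x = (\<Prod>j\<in>UNIV. indicator {0..} (x $ j) * exp (- (x $ j)))"

lemma cone_density_measurable[measurable]: "cone_density \<in> borel_measurable borel"
  unfolding cone_density_def by measurable

lemma cone_density_nonneg: "0 \<le> cone_density x"
  by (simp add: cone_density_def prod_nonneg)

lemma cone_density_eq:
  "cone_density x = (if \<forall>j. 0 \<le> x $ j then exp (- (\<Sum>j\<in>UNIV. x $ j)) else 0)"
  by (auto simp: cone_density_def exp_sum[symmetric] sum_negf[symmetric] indicator_def intro!: prod_zero)

lemma vec_lambda_eq_sum_axis: "(\<chi> j. x j) = (\<Sum>j\<in>UNIV. x j *\<^sub>R axis j (1 :: real))"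
  by (simp add: vec_eq_iff axis_def if_distrib cong: if_cong)

lemma measurable_vec_lambda: "(\<lambda>x. \<chi> j. x j :: real ^ 'd) \<in> borel_measurable (lborel_on UNIV)"
  unfolding vec_lambda_eq_sum_axis by measurable

lemma nn_integral_PiM_vec:
  fixes F :: "real ^ 'd \<Rightarrow> ennreal"
  assumes [measurable]: "F \<in> borel_measurable borel"
  shows "(\<integral>\<^sup>+x. F (\<chi> j. x j) \<partial>lborel_on UNIV) = (\<integral>\<^sup>+x. F x \<partial>lborel)"
proof -
  have "orthonormal_family UNIV (\<lambda>j::'d. axis j 1 :: real ^ 'd)"
    by (auto simp: orthonormal_family_def inner_axis_axis)
  moreover have "span (range (\<lambda>j::'d. axis j 1 :: real ^ 'd)) = UNIV"
    by (metis Basis_vec_real span_Basis)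
  ultimately have a: "orthonormal_basis_of UNIV (\<lambda>j::'d. axis j 1 :: real ^ 'd) ({0}\<^sup>\<bottom>)"
    by (simp add: orthonormal_basis_of_def)
  have v: "orthonormal_basis_of {} (\<lambda>_::nat. 0 :: real ^ 'd) {0}"
    by (simp add: orthonormal_basis_of_def orthonormal_family_def)
  show ?thesis
    by (subst nn_integral_lborel_orthogonal_sum[OF _ _ _ a v])
      (simp_all add: vec_lambda_eq_sum_axis PiM_empty nn_integral_count_space_finite)
qed

text \<open>Both sides are iterated integrals of the function \<open>\<Phi>\<close>, taken in the two possible orders. The Gaussian
  factors, which are absent from the integral of interest, make \<open>\<Phi>\<close> absolutely integrable.\<close>

lemma regularised_integral_PiM:
  fixes a :: "'i \<Rightarrow> real ^ 'd"
  assumes I: "finite I" and \<epsilon>: "\<epsilon> > 0"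
  shows "(CLINT s|lborel_on I. (\<Prod>j\<in>UNIV. 1 / (1 + \<i> * complex_of_real (\<Sum>i\<in>I. a i $ j * s i))) *
      (\<Prod>i\<in>I. complex_of_real (exp (- (\<epsilon> * s i)\<^sup>2 / 2)))) =
    (CLINT x|lborel_on UNIV. complex_of_real (cone_density (\<chi> j. x j) *
      (\<Prod>i\<in>I. sqrt (2 * pi) / \<epsilon> * exp (- ((a i \<bullet> (\<chi> j. x j)) / \<epsilon>)\<^sup>2 / 2))))"
proof -
  interpret I: product_sigma_finite "\<lambda>_::'i. lborel :: real measure" by standard
  interpret I: finite_product_sigma_finite "\<lambda>_::'i. lborel :: real measure" I by standard fact
  interpret U: product_sigma_finite "\<lambda>_::'d. lborel :: real measure" by standard
  interpret U: finite_product_sigma_finite "\<lambda>_::'d. lborel :: real measure" UNIV by standard simp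
  interpret IU: pair_sigma_finite "lborel_on I" "lborel_on (UNIV :: 'd set)" by standard
  define e where "e = (\<lambda>t::real. indicator {0..} t * exp (- t))"
  define K where "K = (\<lambda>t. exp (- (\<epsilon> * t)\<^sup>2 / 2))"
  have [measurable]: "e \<in> borel_measurable borel" "K \<in> borel_measurable borel"
    unfolding e_def K_def by measurable
  have nn: "0 \<le> e t" "0 \<le> K t" for t by (auto simp: e_def K_def)
  define \<Phi> where "\<Phi> s x = (\<Prod>j\<in>UNIV. complex_of_real (e (x j)) * iexp (- (x j * (\<Sum>i\<in>I. a i $ j * s i)))) *
      (\<Prod>i\<in>I. complex_of_real (K (s i)))" for s and x :: "'d \<Rightarrow> real"
  have \<Phi>_alt: "\<Phi> s x = (\<Prod>j\<in>UNIV. complex_of_real (e (x j))) *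
      (\<Prod>i\<in>I. complex_of_real (K (s i)) * iexp (- (s i * (a i \<bullet> (\<chi> j. x j)))))" for s x
  proof -
    (* the phase is the bilinear form of s and x, summed in either order *)
    have "(\<Prod>j\<in>UNIV. iexp (- (x j * (\<Sum>i\<in>I. a i $ j * s i)))) = iexp (\<Sum>j\<in>UNIV. - (x j * (\<Sum>i\<in>I. a i $ j * s i)))"
      by (simp add: exp_sum[symmetric] sum_distrib_left)
    also have "(\<Sum>j\<in>UNIV. - (x j * (\<Sum>i\<in>I. a i $ j * s i))) = (\<Sum>j\<in>UNIV. \<Sum>i\<in>I. - (s i * (a i $ j * x j)))"
      by (simp add: sum_distrib_left sum_negf[symmetric] mult_ac)
    also have "\<dots> = (\<Sum>i\<in>I. - (s i * (a i \<bullet> (\<chi> j. x j))))"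
      by (subst sum.swap) (simp add: inner_vec_def sum_distrib_left sum_negf)
    also have "iexp \<dots> = (\<Prod>i\<in>I. iexp (- (s i * (a i \<bullet> (\<chi> j. x j)))))"
      by (simp add: exp_sum[symmetric] sum_distrib_left I)
    finally show ?thesis
      by (simp add: \<Phi>_def prod.distrib mult_ac)
  qed
  have norm\<Phi>: "norm (\<Phi> s x) = (\<Prod>j\<in>UNIV. e (x j)) * (\<Prod>i\<in>I. K (s i))" for s x
    by (simp add: \<Phi>_def norm_mult prod_norm[symmetric] nn)
  have e_int: "integrable lborel e"
    using has_bochner_integral_I0i_power_exp_m'[of 0]
    by (simp add: e_def has_bochner_integral_iff mult.commute)
  have K_int: "integrable lborel K"
    using gaussian_fourier_transform(1)[OF \<epsilon>, of 0] by (simp add: K_def complex_of_real_integrable_eq)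
  have [measurable]: "(\<lambda>(s, x). \<Phi> s x) \<in> borel_measurable (lborel_on I \<Otimes>\<^sub>M lborel_on UNIV)"
    unfolding \<Phi>_def by measurable
  have int: "integrable (lborel_on I \<Otimes>\<^sub>M lborel_on UNIV) (\<lambda>(s, x). \<Phi> s x)"
  proof (rule IU.Fubini_integrable)
    have eu: "integrable (lborel_on UNIV) (\<lambda>x::'d \<Rightarrow> real. \<Prod>j\<in>UNIV. e (x j))"
      by (intro U.product_integrable_prod e_int) simp
    have ki: "integrable (lborel_on I) (\<lambda>s. \<Prod>i\<in>I. K (s i))"
      by (intro I.product_integrable_prod K_int I)
    show "integrable (lborel_on I) (\<lambda>s. LINT x|lborel_on UNIV. norm (case (s, x) of (s, x) \<Rightarrow> \<Phi> s x))"
      using ki by (simp add: norm\<Phi>)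
    show "AE s in lborel_on I. integrable (lborel_on UNIV) (\<lambda>x. case (s, x) of (s, x) \<Rightarrow> \<Phi> s x)"
    proof (rule AE_I2)
      fix s assume s[measurable]: "s \<in> space (lborel_on I)"
      have "integrable (lborel_on UNIV) (\<lambda>x. norm (\<Phi> s x))"
        using eu by (simp add: norm\<Phi>)
      moreover have "(\<lambda>x. \<Phi> s x) \<in> borel_measurable (lborel_on UNIV)"
        unfolding \<Phi>_def by measurable
      ultimately show "integrable (lborel_on UNIV) (\<lambda>x. case (s, x) of (s, x) \<Rightarrow> \<Phi> s x)"
        by (simp add: integrable_norm_iff)
    qed
  qed simp
  have e_ft: "integrable lborel (\<lambda>x. complex_of_real (e x) * iexp (- (x * t)))"
      "(CLBINT x. complex_of_real (e x) * iexp (- (x * t))) = 1 / (1 + \<i> * complex_of_real t)" for t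
    unfolding e_def by (fact exponential_fourier_transform)+
  have K_ft: "integrable lborel (\<lambda>t. complex_of_real (K t) * iexp (- (t * y)))"
      "(CLBINT t. complex_of_real (K t) * iexp (- (t * y))) =
        complex_of_real (sqrt (2 * pi) / \<epsilon> * exp (- (y / \<epsilon>)\<^sup>2 / 2))" for y
    unfolding K_def by (fact gaussian_fourier_transform[OF \<epsilon>])+
  have left: "(CLINT x|lborel_on UNIV. \<Phi> s x) =
      (\<Prod>j\<in>UNIV. 1 / (1 + \<i> * complex_of_real (\<Sum>i\<in>I. a i $ j * s i))) * (\<Prod>i\<in>I. complex_of_real (K (s i)))" for s
    unfolding \<Phi>_def integral_mult_left_zero
    by (subst U.product_integral_prod[OF _ e_ft(1)]) (simp_all only: e_ft(2) finite_code)
  have right: "(CLINT s|lborel_on I. \<Phi> s x) = complex_of_real (cone_density (\<chi> j. x j) *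
      (\<Prod>i\<in>I. sqrt (2 * pi) / \<epsilon> * exp (- ((a i \<bullet> (\<chi> j. x j)) / \<epsilon>)\<^sup>2 / 2)))" for x
    unfolding \<Phi>_alt integral_mult_right_zero
    by (subst I.product_integral_prod[OF I K_ft(1)])
      (simp only: K_ft(2) of_real_mult of_real_prod cone_density_def e_def vec_lambda_beta)
  show ?thesis
    using IU.Fubini_integral[OF int] by (simp add: left right K_def)
qed

text \<open>In orthonormal coordinates \<open>y\<close> of \<open>V\<^sup>\<bottom>\<close> and \<open>h\<close> of \<open>V\<close> the Gaussian factors depend on \<open>y\<close> alone. The
  substitution \<open>y \<mapsto> \<epsilon> * y\<close> frees them of \<open>\<epsilon>\<close>, which then occurs only as a displacement of the
  argument of the cone density.\<close>

lemma regularised_integral: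
  fixes a :: "'i \<Rightarrow> real ^ 'd" and v :: "'j \<Rightarrow> real ^ 'd"
  assumes V: "subspace V" and IJ: "finite I" "finite J"
    and a: "orthonormal_basis_of I a (V\<^sup>\<bottom>)" and v: "orthonormal_basis_of J v V" and \<epsilon>: "\<epsilon> > 0"
  shows "(CLINT s|lborel_on I. (\<Prod>j\<in>UNIV. 1 / (1 + \<i> * complex_of_real (\<Sum>i\<in>I. a i $ j * s i))) *
      (\<Prod>i\<in>I. complex_of_real (exp (- (\<epsilon> * s i)\<^sup>2 / 2)))) =
    complex_of_real (enn2real (\<integral>\<^sup>+y. (\<Prod>i\<in>I. ennreal (sqrt (2 * pi) * exp (- (y i)\<^sup>2 / 2))) *
      (\<integral>\<^sup>+h. ennreal (cone_density ((\<Sum>i\<in>I. (\<epsilon> * y i) *\<^sub>R a i) + (\<Sum>j\<in>J. h j *\<^sub>R v j))) \<partial>lborel_on J)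
      \<partial>lborel_on I))"
proof -
  interpret J: finite_product_sigma_finite "\<lambda>_::'j. lborel :: real measure" J by standard fact
  define G where "G = (\<lambda>t::real. sqrt (2 * pi) / \<epsilon> * exp (- (t / \<epsilon>)\<^sup>2 / 2))"
  have [measurable]: "G \<in> borel_measurable borel" unfolding G_def by measurable
  have G: "0 \<le> G t" for t using \<epsilon> by (simp add: G_def)
  define F where "F x = cone_density x * (\<Prod>i\<in>I. G (a i \<bullet> x))" for x
  have [measurable]: "F \<in> borel_measurable borel" unfolding F_def by measurable
  have F: "0 \<le> F x" for x by (simp add: F_def cone_density_nonneg prod_nonneg G)
  have vec[measurable]: "(\<lambda>x. \<chi> j. x j) \<in> borel_measurable (lborel_on (UNIV :: 'd set))"
    by (rule measurable_vec_lambda)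
  have inner: "a i \<bullet> ((\<Sum>i\<in>I. y i *\<^sub>R a i) + (\<Sum>j\<in>J. h j *\<^sub>R v j)) = y i" if "i \<in> I" for y h i
  proof -
    have "a i \<in> V\<^sup>\<bottom>"
      using a that by (auto simp: orthonormal_basis_of_def intro: span_base)
    then have "orthogonal (\<Sum>j\<in>J. h j *\<^sub>R v j) (a i)"
      using orthonormal_basis_in[OF v] unfolding orthogonal_comp_def by blast
    then have "a i \<bullet> (\<Sum>j\<in>J. h j *\<^sub>R v j) = 0"
      by (simp add: orthogonal_def inner_commute)
    moreover have "(\<Sum>i\<in>I. y i *\<^sub>R a i) \<bullet> a i = y i"
      using a that by (intro inner_orthonormal_sum IJ) (auto simp: orthonormal_basis_of_def)
    ultimately show ?thesis by (simp add: inner_add_right inner_commute)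
  qed
  have "(CLINT x|lborel_on UNIV. complex_of_real (F (\<chi> j. x j))) =
      complex_of_real (LINT x|lborel_on UNIV. F (\<chi> j. x j))"
    by (rule integral_complex_of_real)
  also have "(LINT x|lborel_on UNIV. F (\<chi> j. x j)) =
      enn2real (\<integral>\<^sup>+x. ennreal (F (\<chi> j. x j)) \<partial>lborel_on UNIV)"
    by (rule integral_eq_nn_integral) (auto simp: F)
  also have "(\<integral>\<^sup>+x. ennreal (F (\<chi> j. x j)) \<partial>lborel_on UNIV) = (\<integral>\<^sup>+x. ennreal (F x) \<partial>lborel)"
    by (rule nn_integral_PiM_vec) measurable
  also have "\<dots> = (\<integral>\<^sup>+y. \<integral>\<^sup>+h. ennreal (F ((\<Sum>i\<in>I. y i *\<^sub>R a i) + (\<Sum>j\<in>J. h j *\<^sub>R v j))) \<partial>lborel_on J \<partial>lborel_on I)"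
    by (rule nn_integral_lborel_orthogonal_sum[OF V IJ a v]) measurable
  also have "\<dots> = (\<integral>\<^sup>+y. (\<Prod>i\<in>I. ennreal (G (y i))) *
      (\<integral>\<^sup>+h. ennreal (cone_density ((\<Sum>i\<in>I. y i *\<^sub>R a i) + (\<Sum>j\<in>J. h j *\<^sub>R v j))) \<partial>lborel_on J) \<partial>lborel_on I)"
    by (simp add: F_def inner ennreal_mult cone_density_nonneg prod_nonneg G prod_ennreal mult.commute
      flip: nn_integral_cmult)
  also have "\<dots> = ennreal (\<epsilon> ^ card I) * (\<integral>\<^sup>+y. (\<Prod>i\<in>I. ennreal (G (\<epsilon> * y i))) *
      (\<integral>\<^sup>+h. ennreal (cone_density ((\<Sum>i\<in>I. (\<epsilon> * y i) *\<^sub>R a i) + (\<Sum>j\<in>J. h j *\<^sub>R v j))) \<partial>lborel_on J) \<partial>lborel_on I)"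
    using \<epsilon> by (subst nn_integral_PiM_affine[where r=\<epsilon> and c="\<lambda>_. 0"]) (simp_all add: IJ)
  also have "\<dots> = (\<integral>\<^sup>+y. ennreal (\<epsilon> ^ card I) * ((\<Prod>i\<in>I. ennreal (G (\<epsilon> * y i))) *
      (\<integral>\<^sup>+h. ennreal (cone_density ((\<Sum>i\<in>I. (\<epsilon> * y i) *\<^sub>R a i) + (\<Sum>j\<in>J. h j *\<^sub>R v j))) \<partial>lborel_on J)) \<partial>lborel_on I)"
    by (rule nn_integral_cmult[symmetric]) measurable
  also have "\<dots> = (\<integral>\<^sup>+y. (\<Prod>i\<in>I. ennreal (sqrt (2 * pi) * exp (- (y i)\<^sup>2 / 2))) *
      (\<integral>\<^sup>+h. ennreal (cone_density ((\<Sum>i\<in>I. (\<epsilon> * y i) *\<^sub>R a i) + (\<Sum>j\<in>J. h j *\<^sub>R v j))) \<partial>lborel_on J) \<partial>lborel_on I)"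
  proof (rule nn_integral_cong)
    fix y :: "'i \<Rightarrow> real"
    have "ennreal (\<epsilon> ^ card I) * (\<Prod>i\<in>I. ennreal (G (\<epsilon> * y i))) = (\<Prod>i\<in>I. ennreal (sqrt (2 * pi) * exp (- (y i)\<^sup>2 / 2)))"
      using \<epsilon> G by (simp add: prod_ennreal ennreal_mult[symmetric] prod_nonneg prod_constant[symmetric]
          prod.distrib[symmetric] G_def del: prod_constant)
    then show "ennreal (\<epsilon> ^ card I) * ((\<Prod>i\<in>I. ennreal (G (\<epsilon> * y i))) *
      (\<integral>\<^sup>+h. ennreal (cone_density ((\<Sum>i\<in>I. (\<epsilon> * y i) *\<^sub>R a i) + (\<Sum>j\<in>J. h j *\<^sub>R v j))) \<partial>lborel_on J)) =
      (\<Prod>i\<in>I. ennreal (sqrt (2 * pi) * exp (- (y i)\<^sup>2 / 2))) *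
      (\<integral>\<^sup>+h. ennreal (cone_density ((\<Sum>i\<in>I. (\<epsilon> * y i) *\<^sub>R a i) + (\<Sum>j\<in>J. h j *\<^sub>R v j))) \<partial>lborel_on J)"
      by (simp add: mult.assoc[symmetric])
  qed
  finally show ?thesis
    using regularised_integral_PiM[OF IJ(1) \<epsilon>, of a] by (simp add: F_def G_def)
qed

section \<open>Fourier inversion at the origin\<close>

text \<open>A hyperplane is a null set: once the coordinates other than \<open>i\<close> are fixed, one value of the \<open>i\<close>-th remains.\<close>

lemma AE_linear_form_neq:
  fixes c :: "'j \<Rightarrow> real"
  assumes J: "finite J" and i: "i \<in> J" "c i \<noteq> 0"
  shows "AE h in lborel_on J. (\<Sum>j\<in>J. h j * c j) \<noteq> r"
proof -
  interpret product_sigma_finite "\<lambda>_::'j. lborel :: real measure" by standard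
  let ?f = "\<lambda>h. indicator {r} (\<Sum>j\<in>J. h j * c j) :: ennreal"
  have J': "J = insert i (J - {i})" using i by auto
  have "(\<integral>\<^sup>+h. ?f h \<partial>lborel_on J) = (\<integral>\<^sup>+h. ?f h \<partial>lborel_on (insert i (J - {i})))"
    using J' by simp
  also have "\<dots> = (\<integral>\<^sup>+h. \<integral>\<^sup>+t. ?f (h(i := t)) \<partial>lborel \<partial>lborel_on (J - {i}))"
    using J by (intro product_nn_integral_insert) (auto simp: insert_absorb[OF i(1)])
  also have "\<dots> = (\<integral>\<^sup>+h. 0 \<partial>lborel_on (J - {i}))"
  proof (rule nn_integral_cong)
    fix h :: "'j \<Rightarrow> real"
    have "(\<Sum>j\<in>J. (h(i := t)) j * c j) = t * c i + (\<Sum>j\<in>J - {i}. h j * c j)" for t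
      using J i by (subst sum.remove[of _ i]) (auto intro!: sum.cong)
    then have "?f (h(i := t)) \<le> indicator {(r - (\<Sum>j\<in>J - {i}. h j * c j)) / c i} t" for t
      using i(2) by (auto simp: indicator_def field_simps)
    then have "(\<integral>\<^sup>+t. ?f (h(i := t)) \<partial>lborel) \<le>
        (\<integral>\<^sup>+t. indicator {(r - (\<Sum>j\<in>J - {i}. h j * c j)) / c i} t \<partial>lborel)"
      by (rule nn_integral_mono)
    then show "(\<integral>\<^sup>+t. ?f (h(i := t)) \<partial>lborel) = 0" by simp
  qed
  finally have "(\<integral>\<^sup>+h. ?f h \<partial>lborel_on J) = 0" by simp
  then have "AE h in lborel_on J. ?f h = 0"
    by (subst (asm) nn_integral_0_iff_AE) auto
  then show ?thesis
    by eventually_elim (auto simp: indicator_def split: if_splits)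
qed

lemma cone_density_le_exp_norm: "cone_density x \<le> exp (- norm x)"
  using norm_le_l1_cart[of x] by (auto simp: cone_density_eq)

lemma nn_integral_exp_abs_finite:
  assumes "b > 0"
  shows "(\<integral>\<^sup>+t. ennreal (exp (- (b * \<bar>t\<bar>))) \<partial>lborel) < \<infinity>"
proof -
  have "has_bochner_integral lborel (\<lambda>x::real. indicator {0..} x *\<^sub>R exp (- \<bar>x\<bar>)) 1"
    using has_bochner_integral_I0i_power_exp_m'[of 0]
    by (rule has_bochner_integral_cong[THEN iffD1, rotated -1]) (auto simp: indicator_def)
  from has_bochner_integral_even_function[OF this]
  have "integrable lborel (\<lambda>x::real. exp (- \<bar>x\<bar>))"
    by (simp add: has_bochner_integral_iff)
  from lborel_integrable_real_affine[OF this, of b 0]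
  have "integrable lborel (\<lambda>t. exp (- (b * \<bar>t\<bar>)))"
    using assms by (simp add: abs_mult)
  then show ?thesis
    by (simp add: integrable_iff_bounded)
qed

text \<open>A majorant that does not depend on \<open>y\<close>, for dominated convergence. On the orthant the coordinate sum is at
  least the Euclidean norm, and the norm is at least \<open>\<bar>h j\<bar>\<close> for every \<open>j\<close> by orthogonality. Averaging over
  \<open>j\<close> gives a product of integrable functions of one variable each.\<close>

lemma cone_density_orthogonal_sum_le:
  fixes v :: "'j \<Rightarrow> real ^ 'd"
  assumes J: "finite J" and v: "orthonormal_family J v" and y: "\<And>j. j \<in> J \<Longrightarrow> y \<bullet> v j = 0"
  shows "cone_density (y + (\<Sum>j\<in>J. h j *\<^sub>R v j)) \<le> (\<Prod>j\<in>J. exp (- (1 / card J * \<bar>h j\<bar>)))"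
proof -
  let ?x = "y + (\<Sum>j\<in>J. h j *\<^sub>R v j)"
  have "\<bar>h j\<bar> \<le> norm ?x" if "j \<in> J" for j
  proof -
    have "h j = ?x \<bullet> v j"
      using that by (simp add: inner_add_left y inner_orthonormal_sum[OF J v])
    moreover have "norm (v j) = 1"
      using v that by (simp add: orthonormal_family_def norm_eq_1)
    ultimately show ?thesis
      using Cauchy_Schwarz_ineq2[of ?x "v j"] by simp
  qed
  then have "(\<Sum>j\<in>J. \<bar>h j\<bar>) \<le> card J * norm ?x"
    using sum_bounded_above[of J "\<lambda>j. \<bar>h j\<bar>"] by simp
  then have "(\<Sum>j\<in>J. 1 / card J * \<bar>h j\<bar>) \<le> norm ?x"
    by (cases "card J = 0") (auto simp: sum_divide_distrib[symmetric] divide_le_eq mult.commute)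
  then have "exp (- norm ?x) \<le> exp (\<Sum>j\<in>J. - (1 / card J * \<bar>h j\<bar>))"
    by (simp add: sum_negf)
  also have "\<dots> = (\<Prod>j\<in>J. exp (- (1 / card J * \<bar>h j\<bar>)))"
    by (rule exp_sum[OF J])
  finally show ?thesis
    using cone_density_le_exp_norm order_trans by blast
qed

lemma tendsto_cone_density:
  assumes z: "\<And>l. z $ l \<noteq> 0" and x: "(x \<longlongrightarrow> z) F"
  shows "((\<lambda>n. cone_density (x n)) \<longlongrightarrow> cone_density z) F"
  unfolding cone_density_def
proof (intro tendsto_prod tendsto_mult)
  fix l
  have xl: "((\<lambda>n. x n $ l) \<longlongrightarrow> z $ l) F"
    using x by (rule tendsto_vec_nth)
  then show "((\<lambda>n. exp (- (x n $ l))) \<longlongrightarrow> exp (- (z $ l))) F"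
    by (intro tendsto_exp tendsto_minus)
  have "isCont (indicator {0..} :: real \<Rightarrow> real) (z $ l)"
    using z[of l] by (simp add: isCont_indicator frontier_def)
  then show "((\<lambda>n. indicator {0..} (x n $ l) :: real) \<longlongrightarrow> indicator {0..} (z $ l)) F"
    by (rule isCont_tendsto_compose[where f="\<lambda>n. x n $ l", OF _ xl])
qed

text \<open>Fourier inversion at the origin, obtained by letting \<open>\<epsilon>\<close> tend to 0 in the regularised identity.
  Nondegeneracy enters twice. It gives the absolute convergence of the left-hand side. It also says that the
  hyperplanes \<open>x $ j = 0\<close> meet \<open>V\<close> in null sets; as the cone density is continuous away from them, its
  integral over \<open>V + y\<close> is continuous at \<open>y = 0\<close>.\<close>

lemma integral_eq_cone_integral:
  fixes V :: "(real ^ 'd) set" and a :: "'i \<Rightarrow> real ^ 'd" and v :: "'j \<Rightarrow> real ^ 'd"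
  assumes V: "subspace V" and IJ: "finite I" "finite J"
    and a: "orthonormal_basis_of I a (V\<^sup>\<bottom>)" and v: "orthonormal_basis_of J v V"
    and nondegenerate: "\<And>j. \<not> V \<subseteq> {x. x $ j = 0}"
  defines "C \<equiv> \<integral>\<^sup>+h. ennreal (cone_density (\<Sum>j\<in>J. h j *\<^sub>R v j)) \<partial>lborel_on J"
  shows "C < \<infinity>"
    and "(CLINT s|lborel_on I. \<Prod>j\<in>UNIV. 1 / (1 + \<i> * complex_of_real (\<Sum>i\<in>I. a i $ j * s i))) =
      (2 * complex_of_real pi) ^ card I * complex_of_real (enn2real C)"
proof -
  interpret I: product_sigma_finite "\<lambda>_::'i. lborel :: real measure" by standard
  interpret J: product_sigma_finite "\<lambda>_::'j. lborel :: real measure" by standard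
  interpret J: finite_product_sigma_finite "\<lambda>_::'j. lborel :: real measure" J by standard fact
  have ov: "orthonormal_family J v" using v by (simp add: orthonormal_basis_of_def)
  define w where "w h = (\<Prod>j\<in>J. ennreal (exp (- (1 / card J * \<bar>h j\<bar>))))" for h
  have w_int: "(\<integral>\<^sup>+h. w h \<partial>lborel_on J) < \<infinity>"
  proof (cases "J = {}")
    case True
    then show ?thesis by (simp add: w_def PiM_empty nn_integral_count_space_finite)
  next
    case False
    then have "0 < 1 / real (card J)" using IJ by (simp add: card_gt_0_iff)
    from nn_integral_exp_abs_finite[OF this] show ?thesis
      unfolding w_def
      by (subst J.product_nn_integral_prod[where f="\<lambda>_ t. ennreal (exp (- (1 / card J * \<bar>t\<bar>)))"])
        (simp_all add: IJ power_less_top_ennreal)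
  qed
  have [measurable]: "w \<in> borel_measurable (lborel_on J)" unfolding w_def by measurable
  define p where "p y = (\<Prod>i\<in>I. ennreal (sqrt (2 * pi) * exp (- (y i)\<^sup>2 / 2)))" for y :: "'i \<Rightarrow> real"
  have [measurable]: "p \<in> borel_measurable (lborel_on I)" unfolding p_def by measurable
  have p_int: "(\<integral>\<^sup>+y. p y \<partial>lborel_on I) = ennreal ((2 * pi) ^ card I)"
  proof -
    have "(\<integral>\<^sup>+t. ennreal (sqrt (2 * pi) * exp (- t\<^sup>2 / 2)) \<partial>lborel) =
        ennreal (sqrt (2 * pi)) * (\<integral>\<^sup>+t. ennreal (exp (- (1 / sqrt 2 * t)\<^sup>2)) \<partial>lborel)"
      by (subst nn_integral_cmult[symmetric]) (auto simp: ennreal_mult power_divide)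
    also have "\<dots> = ennreal (2 * pi)"
    proof (subst nn_integral_exp_square)
      have "sqrt (2 * pi) * (sqrt pi / \<bar>1 / sqrt 2\<bar>) = sqrt (2 * pi) * sqrt (2 * pi)"
        by (simp add: real_sqrt_mult)
      then show "ennreal (sqrt (2 * pi)) * ennreal (sqrt pi / \<bar>1 / sqrt 2\<bar>) = ennreal (2 * pi)"
        by (subst ennreal_mult[symmetric]) simp_all
    qed simp
    finally show ?thesis
      unfolding p_def
      by (subst I.product_nn_integral_prod[where f="\<lambda>_ t. ennreal (sqrt (2 * pi) * exp (- t\<^sup>2 / 2))"])
        (simp_all add: IJ ennreal_power)
  qed
  define S where "S y = (\<Sum>i\<in>I. y i *\<^sub>R a i)" for y
  have S_orth: "S y \<bullet> v j = 0" if "j \<in> J" for y j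
  proof -
    have "v j \<in> V"
      using v that by (auto simp: orthonormal_basis_of_def intro: span_base)
    moreover have "S y \<in> V\<^sup>\<bottom>"
      unfolding S_def by (rule orthonormal_basis_in[OF a])
    ultimately show ?thesis
      by (auto simp: orthogonal_comp_def orthogonal_def inner_commute)
  qed
  have bound: "ennreal (cone_density (S y + (\<Sum>j\<in>J. h j *\<^sub>R v j))) \<le> w h" for y h
    using cone_density_orthogonal_sum_le[OF IJ(2) ov S_orth]
    by (simp add: w_def prod_ennreal ennreal_leI)
  have [measurable]: "(\<lambda>h. \<Sum>j\<in>J. h j *\<^sub>R v j) \<in> borel_measurable (lborel_on J)"
    "S \<in> borel_measurable (lborel_on I)"
    unfolding S_def by measurable
  have "C \<le> (\<integral>\<^sup>+h. w h \<partial>lborel_on J)"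
    unfolding C_def using bound[of "\<lambda>_. 0"] by (intro nn_integral_mono) (simp add: S_def)
  with w_int show C: "C < \<infinity>" by (rule le_less_trans[rotated])
  define \<epsilon> where "\<epsilon> N = 1 / real (Suc N)" for N
  have \<epsilon>: "\<epsilon> N > 0" "\<epsilon> \<longlonglongrightarrow> 0" for N
    unfolding \<epsilon>_def using LIMSEQ_inverse_real_of_nat by (simp_all add: inverse_eq_divide)
  define S\<epsilon> where "S\<epsilon> N y = S (\<lambda>i. \<epsilon> N * y i)" for N y
  have S\<epsilon>: "(\<lambda>N. S\<epsilon> N y) \<longlonglongrightarrow> 0" for y
    unfolding S\<epsilon>_def S_def by (auto intro!: tendsto_eq_intros \<epsilon>(2))
  have [measurable]: "S\<epsilon> N \<in> borel_measurable (lborel_on I)" for N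
    unfolding S\<epsilon>_def S_def by measurable
  (* almost every point of V avoids the boundary of the orthant *)
  have generic: "AE h in lborel_on J. \<forall>l. (\<Sum>j\<in>J. h j *\<^sub>R v j) $ l \<noteq> 0"
  proof -
    have "AE h in lborel_on J. (\<Sum>j\<in>J. h j *\<^sub>R v j) $ l \<noteq> 0" for l
    proof -
      obtain x where x: "x \<in> V" "x $ l \<noteq> 0"
        using nondegenerate[of l] by auto
      have "\<exists>j\<in>J. v j $ l \<noteq> 0"
      proof (rule ccontr)
        assume "\<not> (\<exists>j\<in>J. v j $ l \<noteq> 0)"
        then have "(\<Sum>j\<in>J. (x \<bullet> v j) *\<^sub>R v j) $ l = 0" by simp
        then show False
          using x by (simp only: orthonormal_basis_sum[OF IJ(2) v x(1)])
      qed
      then obtain j where "j \<in> J" "v j $ l \<noteq> 0" by blast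
      from AE_linear_form_neq[where c="\<lambda>j. v j $ l" and r=0, OF IJ(2) this] show ?thesis by simp
    qed
    then show ?thesis by (simp add: AE_all_countable AE_finite_all)
  qed
  have inner_lim: "(\<lambda>N. \<integral>\<^sup>+h. ennreal (cone_density (S\<epsilon> N y + (\<Sum>j\<in>J. h j *\<^sub>R v j))) \<partial>lborel_on J) \<longlonglongrightarrow> C" for y
    unfolding C_def
  proof (rule nn_integral_dominated_convergence[where w=w])
    show "AE h in lborel_on J. (\<lambda>N. ennreal (cone_density (S\<epsilon> N y + (\<Sum>j\<in>J. h j *\<^sub>R v j)))) \<longlonglongrightarrow>
        ennreal (cone_density (\<Sum>j\<in>J. h j *\<^sub>R v j))"
      using generic
    proof eventually_elim
      fix h assume "\<forall>l. (\<Sum>j\<in>J. h j *\<^sub>R v j) $ l \<noteq> 0"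
      moreover have "(\<lambda>N. S\<epsilon> N y + (\<Sum>j\<in>J. h j *\<^sub>R v j)) \<longlonglongrightarrow> 0 + (\<Sum>j\<in>J. h j *\<^sub>R v j)"
        by (intro tendsto_intros S\<epsilon>)
      ultimately show "(\<lambda>N. ennreal (cone_density (S\<epsilon> N y + (\<Sum>j\<in>J. h j *\<^sub>R v j)))) \<longlonglongrightarrow>
          ennreal (cone_density (\<Sum>j\<in>J. h j *\<^sub>R v j))"
        by (intro tendsto_ennrealI tendsto_cone_density) auto
    qed
    show "AE h in lborel_on J. ennreal (cone_density (S\<epsilon> N y + (\<Sum>j\<in>J. h j *\<^sub>R v j))) \<le> w h" for N
      unfolding S\<epsilon>_def by (intro AE_I2 bound)
  qed (use w_int in simp_all)
  define X where "X N = (\<integral>\<^sup>+y. p y * (\<integral>\<^sup>+h. ennreal (cone_density (S\<epsilon> N y + (\<Sum>j\<in>J. h j *\<^sub>R v j))) \<partial>lborel_on J)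
      \<partial>lborel_on I)" for N
  have "X \<longlonglongrightarrow> (\<integral>\<^sup>+y. p y * C \<partial>lborel_on I)"
    unfolding X_def
  proof (rule nn_integral_dominated_convergence[where w="\<lambda>y. p y * (\<integral>\<^sup>+h. w h \<partial>lborel_on J)"])
    show "AE y in lborel_on I. p y * (\<integral>\<^sup>+h. ennreal (cone_density (S\<epsilon> N y + (\<Sum>j\<in>J. h j *\<^sub>R v j))) \<partial>lborel_on J)
        \<le> p y * (\<integral>\<^sup>+h. w h \<partial>lborel_on J)" for N
      unfolding S\<epsilon>_def by (intro AE_I2 mult_left_mono nn_integral_mono bound) simp
    show "(\<integral>\<^sup>+y. p y * (\<integral>\<^sup>+h. w h \<partial>lborel_on J) \<partial>lborel_on I) < \<infinity>"
      using w_int by (simp add: nn_integral_multc p_int ennreal_mult_less_top)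
    show "AE y in lborel_on I. (\<lambda>N. p y * (\<integral>\<^sup>+h. ennreal (cone_density (S\<epsilon> N y + (\<Sum>j\<in>J. h j *\<^sub>R v j))) \<partial>lborel_on J))
        \<longlonglongrightarrow> p y * C"
      by (intro AE_I2 ennreal_tendsto_cmult inner_lim) (simp add: p_def prod_ennreal)
  qed measurable
  also have "(\<integral>\<^sup>+y. p y * C \<partial>lborel_on I) = ennreal ((2 * pi) ^ card I * enn2real C)"
    using C by (simp add: nn_integral_multc p_int ennreal_mult)
  finally have "(\<lambda>N. enn2real (X N)) \<longlonglongrightarrow> (2 * pi) ^ card I * enn2real C"
    by (rule tendsto_enn2real) simp
  then have right: "(\<lambda>N. complex_of_real (enn2real (X N))) \<longlonglongrightarrow> complex_of_real ((2 * pi) ^ card I * enn2real C)"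
    by (rule tendsto_of_real)
  define f where "f s = (\<Prod>j\<in>UNIV. 1 / (1 + \<i> * complex_of_real (\<Sum>i\<in>I. a i $ j * s i)))" for s
  have f_int: "integrable (lborel_on I) f"
    unfolding f_def by (rule integrable_prod_inverse_linear_form[OF V IJ(1) a nondegenerate])
  have [measurable]: "f \<in> borel_measurable (lborel_on I)"
    using f_int by simp
  have left: "(\<lambda>N. CLINT s|lborel_on I. f s * (\<Prod>i\<in>I. complex_of_real (exp (- (\<epsilon> N * s i)\<^sup>2 / 2)))) \<longlonglongrightarrow>
      (CLINT s|lborel_on I. f s)"
  proof (rule integral_dominated_convergence[where w="\<lambda>s. norm (f s)"])
    show "integrable (lborel_on I) (\<lambda>s. norm (f s))"
      using f_int by (rule integrable_norm)
    show "AE s in lborel_on I. (\<lambda>N. f s * (\<Prod>i\<in>I. complex_of_real (exp (- (\<epsilon> N * s i)\<^sup>2 / 2)))) \<longlonglongrightarrow> f s"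
    proof (rule AE_I2)
      fix s :: "'i \<Rightarrow> real"
      have "(\<lambda>N. exp (- (\<epsilon> N * s i)\<^sup>2 / 2)) \<longlonglongrightarrow> exp (- (0 * s i)\<^sup>2 / 2)" for i
        by (intro tendsto_intros \<epsilon>(2)) simp
      then have "(\<lambda>N. f s * (\<Prod>i\<in>I. complex_of_real (exp (- (\<epsilon> N * s i)\<^sup>2 / 2)))) \<longlonglongrightarrow>
          f s * (\<Prod>i\<in>I. complex_of_real (exp (- (0 * s i)\<^sup>2 / 2)))"
        by (intro tendsto_mult tendsto_const tendsto_prod tendsto_of_real)
      then show "(\<lambda>N. f s * (\<Prod>i\<in>I. complex_of_real (exp (- (\<epsilon> N * s i)\<^sup>2 / 2)))) \<longlonglongrightarrow> f s"
        by simp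
    qed
    show "AE s in lborel_on I. norm (f s * (\<Prod>i\<in>I. complex_of_real (exp (- (\<epsilon> N * s i)\<^sup>2 / 2)))) \<le> norm (f s)" for N
    proof (rule AE_I2)
      fix s :: "'i \<Rightarrow> real"
      have "norm (\<Prod>i\<in>I. complex_of_real (exp (- (\<epsilon> N * s i)\<^sup>2 / 2))) \<le> 1"
        unfolding prod_norm[symmetric] by (intro prod_le_1) auto
      then show "norm (f s * (\<Prod>i\<in>I. complex_of_real (exp (- (\<epsilon> N * s i)\<^sup>2 / 2)))) \<le> norm (f s)"
        unfolding norm_mult by (rule mult_left_le) simp
    qed
  qed measurable
  have "(CLINT s|lborel_on I. f s * (\<Prod>i\<in>I. complex_of_real (exp (- (\<epsilon> N * s i)\<^sup>2 / 2)))) =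
      complex_of_real (enn2real (X N))" for N
    unfolding f_def X_def p_def S\<epsilon>_def S_def by (rule regularised_integral[OF V IJ a v \<epsilon>(1)])
  with left have "(\<lambda>N. complex_of_real (enn2real (X N))) \<longlonglongrightarrow> (CLINT s|lborel_on I. f s)"
    by simp
  from LIMSEQ_unique[OF this right]
  show "(CLINT s|lborel_on I. \<Prod>j\<in>UNIV. 1 / (1 + \<i> * complex_of_real (\<Sum>i\<in>I. a i $ j * s i))) =
      (2 * complex_of_real pi) ^ card I * complex_of_real (enn2real C)"
    by (simp add: f_def)
qed

section \<open>Charts of affine subspaces\<close>

lemma closed_standard_simplex: "closed (standard_simplex :: (real ^ 'd) set)"
proof -
  have "standard_simplex = {x :: real ^ 'd. (\<Sum>j\<in>UNIV. x $ j) = 1} \<inter> (\<Inter>j. {x. 0 \<le> x $ j})"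
    by (auto simp: standard_simplex_def)
  moreover have "closed {x :: real ^ 'd. (\<Sum>j\<in>UNIV. x $ j) = 1}"
    by (intro closed_Collect_eq continuous_intros)
  moreover have "closed (\<Inter>j. {x :: real ^ 'd. 0 \<le> x $ j})"
    by (intro closed_INT ballI closed_Collect_le continuous_intros)
  ultimately show ?thesis by (metis closed_Int)
qed

lemma affine_chart_measurable[measurable]:
  "affine_chart m p (u :: nat \<Rightarrow> 'a::euclidean_space) \<in> borel_measurable (lborel_on {..<m})"
  unfolding affine_chart_def by measurable

lemma affine_chart_preimage_sets:
  fixes u :: "nat \<Rightarrow> 'a::euclidean_space"
  assumes "A \<in> sets borel"
  shows "{x \<in> space (lborel_on {..<m}). affine_chart m p u x \<in> A} \<in> sets (lborel_on {..<m})"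
  using measurable_sets[OF affine_chart_measurable assms, of m p u]
  by (simp add: vimage_def Int_def conj_commute)

lemma emeasure_affine_chart_preimage_shift:
  fixes u :: "nat \<Rightarrow> 'a::euclidean_space"
  assumes A[measurable]: "A \<in> sets borel"
  shows "emeasure (lborel_on {..<m}) {x \<in> space (lborel_on {..<m}). affine_chart m (p + (\<Sum>i<m. b i *\<^sub>R u i)) u x \<in> A} =
    emeasure (lborel_on {..<m}) {x \<in> space (lborel_on {..<m}). affine_chart m p u x \<in> A}"
proof -
  have emeasure_eq: "emeasure (lborel_on {..<m}) {x \<in> space (lborel_on {..<m}). affine_chart m q u x \<in> A} =
      (\<integral>\<^sup>+x. indicator A (affine_chart m q u x) \<partial>lborel_on {..<m})" for q
    unfolding nn_integral_indicator[symmetric, OF affine_chart_preimage_sets[OF A]]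
    by (rule nn_integral_cong) (simp add: indicator_def)
  have "affine_chart m p u (\<lambda>i\<in>{..<m}. b i + 1 * x i) = affine_chart m (p + (\<Sum>i<m. b i *\<^sub>R u i)) u x" for x
    by (simp add: affine_chart_def scaleR_add_left sum.distrib)
  then show ?thesis
    unfolding emeasure_eq
    by (subst (2) nn_integral_PiM_affine[where r=1 and c=b]) simp_all
qed

text \<open>The set \<open>A\<close> lies in a translate of \<open>S\<close>. A vector orthogonal to \<open>S\<close> but not to \<open>w i\<close> has a constant inner
  product with the points of \<open>A\<close>, and this confines their chart coordinates to a hyperplane.\<close>

lemma emeasure_affine_chart_preimage_null:
  fixes w :: "nat \<Rightarrow> 'a::euclidean_space"
  assumes S: "subspace S" and i: "i < m" "w i \<notin> S" and A: "A \<in> sets borel"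
    and A_S: "\<And>x. x \<in> A \<Longrightarrow> x - q \<in> S"
  shows "emeasure (lborel_on {..<m}) {x \<in> space (lborel_on {..<m}). affine_chart m p w x \<in> A} = 0"
proof -
  have "w i \<notin> S\<^sup>\<bottom>\<^sup>\<bottom>" using i S by (simp add: orthogonal_comp_self)
  then obtain c where c: "c \<in> S\<^sup>\<bottom>" "w i \<bullet> c \<noteq> 0"
    unfolding orthogonal_comp_def[of "S\<^sup>\<bottom>"] by (auto simp: orthogonal_def inner_commute)
  have "AE x in lborel_on {..<m}. (\<Sum>j<m. x j * (w j \<bullet> c)) \<noteq> (q - p) \<bullet> c"
    using i c by (intro AE_linear_form_neq[of _ i]) auto
  then have "AE x in lborel_on {..<m}. affine_chart m p w x \<notin> A"
  proof eventually_elim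
    fix x assume "(\<Sum>j<m. x j * (w j \<bullet> c)) \<noteq> (q - p) \<bullet> c"
    then have "(affine_chart m p w x - q) \<bullet> c \<noteq> 0"
      by (simp add: affine_chart_def inner_add_left inner_diff_left inner_sum_left algebra_simps)
    then show "affine_chart m p w x \<notin> A"
      using A_S c(1) by (auto simp: orthogonal_comp_def orthogonal_def)
  qed
  then show ?thesis
    using affine_chart_preimage_sets[OF A, of m p w]
    by (subst (asm) AE_iff_measurable[OF _ refl]) auto
qed

section \<open>Slicing the cone over the section\<close>

text \<open>The points at height \<open>t\<close> above the span of \<open>u\<close> have coordinate sum \<open>\<rho> * t\<close>. For \<open>t < 0\<close> none of
  them lies in the orthant. For \<open>t > 0\<close> those that do form the section of the simplex, dilated by \<open>\<rho> * t\<close>,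
  and the density on them is constant. Hence the integral over \<open>t\<close> is a Gamma integral.\<close>

lemma nn_integral_cone_density_slices:
  fixes u :: "nat \<Rightarrow> real ^ 'd"
  assumes u: "\<And>i. i < m \<Longrightarrow> (\<Sum>j\<in>UNIV. u i $ j) = 0"
    and e: "(\<Sum>j\<in>UNIV. e $ j) = \<rho>" and \<rho>: "\<rho> > 0"
  shows "(\<integral>\<^sup>+h. ennreal (cone_density (\<Sum>i<Suc m. h i *\<^sub>R (if i = m then e else u i))) \<partial>lborel_on {..<Suc m}) =
    ennreal (fact m / \<rho>) *
    emeasure (lborel_on {..<m}) {x \<in> space (lborel_on {..<m}). affine_chart m ((1 / \<rho>) *\<^sub>R e) u x \<in> standard_simplex}"
    (is "_ = _ * emeasure _ ?A")
proof -
  interpret product_sigma_finite "\<lambda>_::nat. lborel :: real measure" by standard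
  have A[measurable]: "?A \<in> sets (lborel_on {..<m})"
    by (intro affine_chart_preimage_sets borel_closed closed_standard_simplex)
  define M where "M = emeasure (lborel_on {..<m}) ?A"
  have sum0: "(\<Sum>j\<in>UNIV. (\<Sum>i<m. x i *\<^sub>R u i) $ j) = 0" for x
  proof -
    have "(\<Sum>j\<in>UNIV. (\<Sum>i<m. x i *\<^sub>R u i) $ j) = (\<Sum>i<m. x i * (\<Sum>j\<in>UNIV. u i $ j))"
      by (simp add: sum_distrib_left) (rule sum.swap)
    then show ?thesis by (simp add: u)
  qed
  define F where "F t x = ennreal (cone_density (t *\<^sub>R e + (\<Sum>i<m. x i *\<^sub>R u i)))" for t x
  have slice: "(\<integral>\<^sup>+x. F t x \<partial>lborel_on {..<m}) =
      ennreal ((\<rho> * t) ^ m * exp (- (\<rho> * t))) * indicator {0..} (\<rho> * t) * M" if "t \<noteq> 0" for t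
  proof (cases "t > 0")
    case False
    have "F t x = 0" for x
    proof -
      have "(\<Sum>j\<in>UNIV. (t *\<^sub>R e + (\<Sum>i<m. x i *\<^sub>R u i)) $ j) = t * \<rho>"
        using sum0[of x] by (simp add: sum.distrib e flip: sum_distrib_left)
      also have "\<dots> < 0"
        using False that \<rho> by (simp add: mult_less_0_iff)
      finally have "\<not> (\<forall>j. 0 \<le> (t *\<^sub>R e + (\<Sum>i<m. x i *\<^sub>R u i)) $ j)"
        using sum_nonneg[of UNIV "\<lambda>j. (t *\<^sub>R e + (\<Sum>i<m. x i *\<^sub>R u i)) $ j"] by (meson not_le UNIV_I)
      then show ?thesis
        unfolding F_def cone_density_eq by (simp only: if_False ennreal_0)
    qed
    then show ?thesis
      using False that \<rho> by (simp add: indicator_def zero_le_mult_iff)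
  next
    case True
    define r where "r = \<rho> * t"
    have r: "r > 0" using True \<rho> by (simp add: r_def)
    have "(\<integral>\<^sup>+x. F t x \<partial>lborel_on {..<m}) = ennreal (r ^ m) * (\<integral>\<^sup>+x. F t (\<lambda>i\<in>{..<m}. 0 + r * x i) \<partial>lborel_on {..<m})"
      using r unfolding F_def by (subst nn_integral_PiM_affine[where r=r and c="\<lambda>_. 0"]) simp_all
    also have "(\<integral>\<^sup>+x. F t (\<lambda>i\<in>{..<m}. 0 + r * x i) \<partial>lborel_on {..<m}) =
        (\<integral>\<^sup>+x. ennreal (exp (- r)) * indicator ?A x \<partial>lborel_on {..<m})"
    proof (rule nn_integral_cong)
      fix x assume x: "x \<in> space (lborel_on {..<m})"
      define z where "z = affine_chart m ((1 / \<rho>) *\<^sub>R e) u x"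
      have "t *\<^sub>R e + (\<Sum>i<m. (\<lambda>i\<in>{..<m}. 0 + r * x i) i *\<^sub>R u i) = r *\<^sub>R z"
        using \<rho> by (simp add: z_def affine_chart_def r_def scaleR_sum_right scaleR_add_right)
      then have Fz: "F t (\<lambda>i\<in>{..<m}. 0 + r * x i) = ennreal (cone_density (r *\<^sub>R z))"
        by (simp only: F_def)
      have "(\<Sum>j\<in>UNIV. z $ j) = 1"
        using sum0[of x] e \<rho> by (simp add: z_def affine_chart_def sum.distrib flip: sum_divide_distrib)
      then have "cone_density (r *\<^sub>R z) = exp (- r) * indicator standard_simplex z"
        using r by (auto simp: cone_density_eq standard_simplex_def indicator_def zero_le_mult_iff
            simp flip: sum_distrib_left)
      then show "F t (\<lambda>i\<in>{..<m}. 0 + r * x i) = ennreal (exp (- r)) * indicator ?A x"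
        unfolding Fz using x by (auto simp: z_def indicator_def)
    qed
    also have "\<dots> = ennreal (exp (- r)) * M"
      by (simp add: nn_integral_cmult_indicator M_def)
    finally show ?thesis
      using r by (simp add: r_def[symmetric] ennreal_mult mult.assoc)
  qed
  have gamma: "(\<integral>\<^sup>+t. ennreal ((\<rho> * t) ^ m * exp (- (\<rho> * t))) * indicator {0..} (\<rho> * t) \<partial>lborel) = ennreal (fact m / \<rho>)"
  proof -
    have "ennreal (fact m) = (\<integral>\<^sup>+t. ennreal (t ^ m * exp (- t)) * indicator {0..} t \<partial>lborel)"
      using nn_intergal_power_times_exp_Ici[of m] by simp
    also have "\<dots> = ennreal \<rho> * (\<integral>\<^sup>+t. ennreal ((\<rho> * t) ^ m * exp (- (\<rho> * t))) * indicator {0..} (\<rho> * t) \<partial>lborel)"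
      using \<rho> nn_integral_real_affine[of "\<lambda>t. ennreal (t ^ m * exp (- t)) * indicator {0..} t" \<rho> 0] by simp
    finally have *: "ennreal (fact m) = ennreal \<rho> *
      (\<integral>\<^sup>+t. ennreal ((\<rho> * t) ^ m * exp (- (\<rho> * t))) * indicator {0..} (\<rho> * t) \<partial>lborel)" .
    have "ennreal \<rho> * ennreal (fact m / \<rho>) = ennreal (fact m)"
      using \<rho> by (subst ennreal_mult[symmetric]) simp_all
    also note *
    finally show ?thesis
      using \<rho> unfolding ennreal_mult_cancel_left by simp
  qed
  have "(\<integral>\<^sup>+h. ennreal (cone_density (\<Sum>i<Suc m. h i *\<^sub>R (if i = m then e else u i))) \<partial>lborel_on {..<Suc m}) =
      (\<integral>\<^sup>+t. \<integral>\<^sup>+x. ennreal (cone_density (\<Sum>i<Suc m. (x(m := t)) i *\<^sub>R (if i = m then e else u i)))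
        \<partial>lborel_on {..<m} \<partial>lborel)"
    unfolding lessThan_Suc by (rule product_nn_integral_insert_rev) auto
  also have "\<dots> = (\<integral>\<^sup>+t. \<integral>\<^sup>+x. F t x \<partial>lborel_on {..<m} \<partial>lborel)"
  proof -
    have "(\<Sum>i<Suc m. (x(m := t)) i *\<^sub>R (if i = m then e else u i)) = t *\<^sub>R e + (\<Sum>i<m. x i *\<^sub>R u i)" for x t
    proof -
      have "(\<Sum>i<m. (x(m := t)) i *\<^sub>R (if i = m then e else u i)) = (\<Sum>i<m. x i *\<^sub>R u i)"
        by (intro sum.cong) auto
      then show ?thesis by (simp add: add.commute)
    qed
    then show ?thesis by (simp only: F_def)
  qed
  also have "\<dots> = (\<integral>\<^sup>+t. ennreal ((\<rho> * t) ^ m * exp (- (\<rho> * t))) * indicator {0..} (\<rho> * t) * M \<partial>lborel)"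
    by (rule nn_integral_cong_AE, rule AE_mp[OF AE_lborel_singleton[of 0]]) (simp add: slice)
  also have "\<dots> = ennreal (fact m / \<rho>) * M"
    by (simp add: nn_integral_multc gamma)
  finally show ?thesis by (simp add: M_def)
qed

lemma orthonormal_basis_insert_normal:
  fixes u :: "nat \<Rightarrow> 'a::euclidean_space"
  assumes H: "subspace H" and e: "e \<in> H" "norm e = 1"
    and u: "orthonormal_basis_of {..<m} u {x \<in> H. e \<bullet> x = 0}"
  shows "orthonormal_basis_of {..<Suc m} (\<lambda>i. if i = m then e else u i) H"
proof -
  let ?v = "\<lambda>i. if i = m then e else u i"
  have u_in: "u i \<in> H" "e \<bullet> u i = 0" if "i < m" for i
  proof -
    have "u i \<in> {x \<in> H. e \<bullet> x = 0}"
      using u that by (auto simp: orthonormal_basis_of_def intro: span_base)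
    then show "u i \<in> H" "e \<bullet> u i = 0" by auto
  qed
  have "orthonormal_family {..<Suc m} ?v"
    using u e u_in by (auto simp: orthonormal_basis_of_def orthonormal_family_def norm_eq_1 inner_commute)
  moreover have "span (?v ` {..<Suc m}) = H"
  proof
    have "?v ` {..<Suc m} \<subseteq> H" using u_in e by auto
    then show "span (?v ` {..<Suc m}) \<subseteq> H" using H by (rule span_minimal)
    show "H \<subseteq> span (?v ` {..<Suc m})"
    proof
      fix x assume x: "x \<in> H"
      have "x - (e \<bullet> x) *\<^sub>R e \<in> {x \<in> H. e \<bullet> x = 0}"
        using x e H by (simp add: subspace_diff subspace_scale inner_diff_right norm_eq_1)
      also have "\<dots> = span (u ` {..<m})"
        using u by (simp add: orthonormal_basis_of_def)
      also have "\<dots> \<subseteq> span (?v ` {..<Suc m})"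
        by (rule span_mono) force
      finally have "x - (e \<bullet> x) *\<^sub>R e \<in> span (?v ` {..<Suc m})" .
      moreover have "(e \<bullet> x) *\<^sub>R e \<in> span (?v ` {..<Suc m})"
        by (intro span_scale span_base) force
      ultimately have "x - (e \<bullet> x) *\<^sub>R e + (e \<bullet> x) *\<^sub>R e \<in> span (?v ` {..<Suc m})"
        by (rule span_add)
      then show "x \<in> span (?v ` {..<Suc m})" by simp
    qed
  qed
  ultimately show ?thesis by (simp add: orthonormal_basis_of_def)
qed

lemma orthonormal_family_spans:
  fixes u :: "'i \<Rightarrow> 'a::euclidean_space"
  assumes u: "orthonormal_family I u" and S: "subspace S" "u ` I \<subseteq> S" "card I = dim S"
  shows "orthonormal_basis_of I u S"
proof -
  have "S \<subseteq> span (u ` I)"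
    using u S card_image[OF orthonormal_family_inj_on[OF u]]
    by (intro card_ge_dim_independent orthonormal_family_independent) auto
  moreover have "span (u ` I) \<subseteq> S"
    using S by (intro span_minimal) auto
  ultimately show ?thesis
    using u by (simp add: orthonormal_basis_of_def)
qed

section \<open>The volume of the section\<close>

text \<open>Here \<open>q\<close> is the orthogonal projection of the all-ones vector to \<open>H\<close>, characterised as the vector of \<open>H\<close>
  that represents the coordinate sum. The affine subspace of \<open>H\<close> on which the coordinate sum is 1 has the
  foot point \<open>q / (norm q)\<^sup>2\<close> and the direction space spanned by \<open>u\<close>.\<close>

lemma section_integral_formula:
  fixes H :: "(real ^ 'd) set" and a :: "'i \<Rightarrow> real ^ 'd" and u :: "nat \<Rightarrow> real ^ 'd"
  assumes H: "subspace H" and I: "finite I" and a: "orthonormal_basis_of I a (H\<^sup>\<bottom>)"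
    and nondegenerate: "\<And>j. \<not> H \<subseteq> {x. x $ j = 0}"
    and q: "q \<in> H" "\<And>x. x \<in> H \<Longrightarrow> q \<bullet> x = (\<Sum>j\<in>UNIV. x $ j)" "q \<noteq> 0"
    and u: "orthonormal_basis_of {..<m} u {x \<in> H. q \<bullet> x = 0}"
  shows "(CLINT s|lborel_on I. \<Prod>j\<in>UNIV. 1 / (1 + \<i> * complex_of_real (\<Sum>i\<in>I. a i $ j * s i))) =
    (2 * complex_of_real pi) ^ card I * complex_of_real (fact m / norm q *
      measure (lborel_on {..<m}) {x \<in> space (lborel_on {..<m}).
        affine_chart m ((1 / (norm q)\<^sup>2) *\<^sub>R q) u x \<in> H \<inter> standard_simplex})"
proof -
  define e where "e = (1 / norm q) *\<^sub>R q"
  have norm_q: "norm q > 0" using q(3) by simp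
  have e: "e \<in> H" "norm e = 1"
    using q H by (simp_all add: e_def subspace_scale)
  have "{x \<in> H. e \<bullet> x = 0} = {x \<in> H. q \<bullet> x = 0}"
    using norm_q by (auto simp: e_def)
  then have v: "orthonormal_basis_of {..<Suc m} (\<lambda>i. if i = m then e else u i) H"
    using u by (intro orthonormal_basis_insert_normal H e) simp
  have u_in: "u i \<in> H" "q \<bullet> u i = 0" if "i < m" for i
  proof -
    have "u i \<in> {x \<in> H. q \<bullet> x = 0}"
      using u that by (auto simp: orthonormal_basis_of_def intro: span_base)
    then show "u i \<in> H" "q \<bullet> u i = 0" by auto
  qed
  have u_sum: "(\<Sum>j\<in>UNIV. u i $ j) = 0" if "i < m" for i
    using u_in[OF that] q(2) by metis
  have "q \<bullet> e = norm q"
    using norm_q by (simp add: e_def power2_norm_eq_inner[symmetric] power2_eq_square)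
  then have e_sum: "(\<Sum>j\<in>UNIV. e $ j) = norm q"
    using q(2)[OF e(1)] by simp
  have center: "(1 / norm q) *\<^sub>R e = (1 / (norm q)\<^sup>2) *\<^sub>R q"
    by (simp add: e_def power2_eq_square)
  have in_H: "affine_chart m ((1 / (norm q)\<^sup>2) *\<^sub>R q) u x \<in> H" for x
    unfolding affine_chart_def using H q(1) u_in(1)
    by (intro subspace_add subspace_scale subspace_sum) auto
  define C where "C = (\<integral>\<^sup>+h. ennreal (cone_density (\<Sum>i<Suc m. h i *\<^sub>R (if i = m then e else u i))) \<partial>lborel_on {..<Suc m})"
  have "C = ennreal (fact m / norm q) * emeasure (lborel_on {..<m}) {x \<in> space (lborel_on {..<m}).
        affine_chart m ((1 / (norm q)\<^sup>2) *\<^sub>R q) u x \<in> H \<inter> standard_simplex}"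
    using nn_integral_cone_density_slices[of m u e "norm q", OF u_sum e_sum norm_q]
    by (simp only: C_def center in_H Int_iff simp_thms)
  then have "enn2real C = fact m / norm q * measure (lborel_on {..<m}) {x \<in> space (lborel_on {..<m}).
        affine_chart m ((1 / (norm q)\<^sup>2) *\<^sub>R q) u x \<in> H \<inter> standard_simplex}"
    by (simp add: enn2real_mult measure_def)
  then show ?thesis
    using integral_eq_cone_integral(2)[OF H I finite_lessThan a v nondegenerate]
    unfolding C_def by simp
qed

text \<open>The chart \<open>(p, w)\<close> behind \<^const>\<open>affine_vol\<close> is an arbitrary choice. If \<open>w\<close> spans the
  direction space \<open>H0\<close>, a translation moves the origin \<open>p\<close> to \<open>c\<close>, and then the directions \<open>w\<close> and \<open>u\<close> give the
  same volume because the Fourier integral expresses both. Otherwise a non-empty section lies in two affine subspaces of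
  the same dimension with different directions, and it is a null set in the charts of both.\<close>

lemma affine_vol_eq_measure_chart:
  fixes H :: "(real ^ 'd) set" and a :: "'i \<Rightarrow> real ^ 'd" and u :: "nat \<Rightarrow> real ^ 'd"
  assumes H: "subspace H" and I: "finite I" and a: "orthonormal_basis_of I a (H\<^sup>\<bottom>)"
    and nondegenerate: "\<And>j. \<not> H \<subseteq> {x. x $ j = 0}"
    and q: "q \<in> H" "\<And>x. x \<in> H \<Longrightarrow> q \<bullet> x = (\<Sum>j\<in>UNIV. x $ j)" "q \<noteq> 0"
    and u: "orthonormal_basis_of {..<m} u {x \<in> H. q \<bullet> x = 0}"
  shows "affine_vol m (H \<inter> standard_simplex) =
      measure (lborel_on {..<m}) {x \<in> space (lborel_on {..<m}).
        affine_chart m ((1 / (norm q)\<^sup>2) *\<^sub>R q) u x \<in> H \<inter> standard_simplex}"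
proof -
  define A where "A = H \<inter> standard_simplex"
  define H0 where "H0 = {x \<in> H. q \<bullet> x = 0}"
  define c where "c = (1 / (norm q)\<^sup>2) *\<^sub>R q"
  define vol where "vol p w = measure (lborel_on {..<m}) {x \<in> space (lborel_on {..<m}). affine_chart m p w x \<in> A}"
    for p and w :: "nat \<Rightarrow> real ^ 'd"
  have A_sets: "A \<in> sets borel"
    unfolding A_def by (intro borel_closed closed_Int closed_subspace H closed_standard_simplex)
  have H0: "subspace H0"
    using H by (auto simp: H0_def subspace_def inner_add_right)
  have u_H0: "orthonormal_basis_of {..<m} u H0"
    using u by (simp add: H0_def)
  have dim_H0: "dim H0 = m"
    using card_orthonormal_basis[OF u_H0] by simp
  have A_H0: "x - c \<in> H0" if "x \<in> A" for x
  proof -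
    have "q \<bullet> x = 1"
      using that q(2)[of x] by (simp add: A_def standard_simplex_def)
    moreover have "q \<bullet> c = 1"
      using q(3) by (simp add: c_def power2_norm_eq_inner)
    ultimately show ?thesis
      using that H q(1) by (simp add: H0_def A_def c_def inner_diff_right subspace_diff subspace_scale)
  qed
  let ?P = "\<lambda>(p, w). orthonormal_family {..<m} w \<and> A \<subseteq> range (affine_chart m p w)"
  have "?P (c, u)"
  proof -
    have "x = affine_chart m c u (\<lambda>i. (x - c) \<bullet> u i)" if "x \<in> A" for x
      using orthonormal_basis_sum[OF finite_lessThan u_H0 A_H0[OF that]] by (simp add: affine_chart_def)
    then show ?thesis
      using u by (auto simp: orthonormal_basis_of_def)
  qed
  then have "?P (SOME x. ?P x)" by (rule someI)
  then obtain p w where pw: "(SOME x. ?P x) = (p, w)" and w: "orthonormal_family {..<m} w"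
    and A_range: "A \<subseteq> range (affine_chart m p w)"
    by (cases "SOME x. ?P x") auto
  have "affine_vol m A = vol p w"
    unfolding affine_vol_def pw Let_def prod.case vol_def
    by (rule measure_completion) (rule affine_chart_preimage_sets[OF A_sets])
  also have "vol p w = vol c u"
  proof (cases "A = {}")
    case True
    then show ?thesis by (simp add: vol_def)
  next
    case False
    show ?thesis
    proof (cases "w ` {..<m} \<subseteq> H0")
      case True
      have w_H0: "orthonormal_basis_of {..<m} w H0"
        using True dim_H0 by (intro orthonormal_family_spans w H0) simp_all
      from False A_range obtain x where "affine_chart m p w x \<in> A" by blast
      then have "affine_chart m p w x - c \<in> H0" by (rule A_H0)
      moreover have "(\<Sum>i<m. x i *\<^sub>R w i) \<in> H0"
        by (rule orthonormal_basis_in[OF w_H0])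
      ultimately have "affine_chart m p w x - c - (\<Sum>i<m. x i *\<^sub>R w i) \<in> H0"
        by (rule subspace_diff[OF H0])
      then have "p - c \<in> H0" by (simp add: affine_chart_def)
      from orthonormal_basis_sum[OF finite_lessThan w_H0 this]
      have "p = c + (\<Sum>i<m. ((p - c) \<bullet> w i) *\<^sub>R w i)" by (simp add: algebra_simps)
      then have "vol p w = vol c w"
        unfolding vol_def measure_def
        using emeasure_affine_chart_preimage_shift[OF A_sets, of m c "\<lambda>i. (p - c) \<bullet> w i" w] by simp
      moreover have "vol c w = vol c u"
      proof -
        have "(2 * complex_of_real pi) ^ card I * complex_of_real (fact m / norm q * vol c w) =
            (2 * complex_of_real pi) ^ card I * complex_of_real (fact m / norm q * vol c u)"
          using section_integral_formula[OF H I a nondegenerate q w_H0[unfolded H0_def]]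
            section_integral_formula[OF H I a nondegenerate q u]
          unfolding vol_def A_def c_def by simp
        then show ?thesis using q(3) by simp
      qed
      ultimately show ?thesis by simp
    next
      case False
      then obtain i where i: "i < m" "w i \<notin> H0" by auto
      have "vol p w = 0"
        unfolding vol_def measure_def
        using emeasure_affine_chart_preimage_null[where w=w and i=i, OF H0 i A_sets A_H0] by simp
      (* span w and H0 have equal dimension, so neither contains the other *)
      have "\<exists>k<m. u k \<notin> span (w ` {..<m})"
      proof (rule ccontr)
        assume "\<not> (\<exists>k<m. u k \<notin> span (w ` {..<m}))"
        then have "span (u ` {..<m}) \<subseteq> span (w ` {..<m})"
          by (intro span_minimal subspace_span) auto
        then have "H0 \<subseteq> span (w ` {..<m})"
          using u_H0 by (simp add: orthonormal_basis_of_def)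
        moreover have "dim (span (w ` {..<m})) = m"
          using card_orthonormal_basis[of "{..<m}" w "span (w ` {..<m})"] w
          by (simp add: orthonormal_basis_of_def)
        ultimately have "H0 = span (w ` {..<m})"
          using dim_H0 H0 by (intro subspace_dim_equal subspace_span) auto
        moreover have "w i \<in> span (w ` {..<m})"
          using i(1) by (intro span_base) auto
        ultimately show False using i(2) by simp
      qed
      then obtain k where k: "k < m" "u k \<notin> span (w ` {..<m})" by blast
      have "x - p \<in> span (w ` {..<m})" if x: "x \<in> A" for x
      proof -
        obtain y where "x = affine_chart m p w y"
          using A_range x by blast
        moreover have "(\<Sum>i<m. y i *\<^sub>R w i) \<in> span (w ` {..<m})"
          by (intro span_sum span_scale span_base) auto
        ultimately show ?thesis by (simp add: affine_chart_def)
      qed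
      from emeasure_affine_chart_preimage_null[where w=u and i=k, OF subspace_span k A_sets this]
      have "vol c u = 0"
        unfolding vol_def measure_def by simp
      with \<open>vol p w = 0\<close> show ?thesis by simp
    qed
  qed
  finally show ?thesis by (simp add: vol_def A_def c_def)
qed

theorem theorem1:
  fixes H :: "(real ^ 'd) set" and n k :: nat and a :: "nat \<Rightarrow> real ^ 'd"
  assumes dim_space: "CARD('d) = n + 1"
    and subspace_H: "subspace H"
    and dim_H: "dim H = k"
    and k: "k \<ge> 1"
    and basis: "orthonormal_basis_of {1..n+1-k} a (orthogonal_comp H)"
    and nondegenerate: "\<And>j. \<not> H \<subseteq> {x. x $ j = 0}"
  shows "integrable (lborel_on {1..n+1-k})
           (\<lambda>s. \<Prod>j\<in>UNIV. 1 / (1 + \<i> * complex_of_real (\<Sum>l=1..n+1-k. a l $ j * s l)))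
       \<and> complex_of_real (affine_vol (k - 1) (H \<inter> standard_simplex)) =
         complex_of_real (sqrt (real (n + 1) - (\<Sum>l=1..n+1-k. (\<Sum>j\<in>UNIV. a l $ j)\<^sup>2))
                            / fact (k - 1))
         * (1 / (2 * complex_of_real pi) ^ (n + 1 - k))
         * (LINT s|lborel_on {1..n+1-k}.
             (\<Prod>j\<in>UNIV. 1 / (1 + \<i> * complex_of_real (\<Sum>l=1..n+1-k. a l $ j * s l))))"
proof
  let ?I = "{1..n+1-k}"
  let ?f = "\<lambda>s. \<Prod>j\<in>UNIV. 1 / (1 + \<i> * complex_of_real (\<Sum>l=1..n+1-k. a l $ j * s l))"
  show "integrable (lborel_on ?I) ?f"
    by (rule integrable_prod_inverse_linear_form[OF subspace_H _ basis nondegenerate]) simp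
  define one where "one = (\<chi> j. 1 :: real ^ 'd)"
  have one_inner: "one \<bullet> x = (\<Sum>j\<in>UNIV. x $ j)" for x
    by (simp add: one_def inner_vec_def)
  (* the orthogonal projection of the all-ones vector to H *)
  define q where "q = one - (\<Sum>l\<in>?I. (one \<bullet> a l) *\<^sub>R a l)"
  have a_orth: "orthonormal_family ?I a"
    using basis by (simp add: orthonormal_basis_of_def)
  have sum_in: "(\<Sum>l\<in>?I. (one \<bullet> a l) *\<^sub>R a l) \<in> H\<^sup>\<bottom>"
    by (rule orthonormal_basis_in[OF basis])
  have "q \<in> H\<^sup>\<bottom>\<^sup>\<bottom>"
    unfolding orthogonal_comp_def[of "H\<^sup>\<bottom>"]
  proof (intro CollectI ballI)
    fix y assume y: "y \<in> H\<^sup>\<bottom>"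
    have "y \<bullet> (\<Sum>l\<in>?I. (one \<bullet> a l) *\<^sub>R a l) = one \<bullet> (\<Sum>l\<in>?I. (y \<bullet> a l) *\<^sub>R a l)"
      by (simp add: inner_sum_right mult.commute)
    also have "(\<Sum>l\<in>?I. (y \<bullet> a l) *\<^sub>R a l) = y"
      by (rule orthonormal_basis_sum[OF _ basis y]) simp
    finally show "orthogonal y q"
      by (simp add: orthogonal_def q_def inner_diff_right inner_commute)
  qed
  then have q_H: "q \<in> H"
    by (simp add: orthogonal_comp_self subspace_H)
  have q_inner: "q \<bullet> x = (\<Sum>j\<in>UNIV. x $ j)" if "x \<in> H" for x
  proof -
    have "orthogonal x (\<Sum>l\<in>?I. (one \<bullet> a l) *\<^sub>R a l)"
      using sum_in that unfolding orthogonal_comp_def by blast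
    then have "(\<Sum>l\<in>?I. (one \<bullet> a l) *\<^sub>R a l) \<bullet> x = 0"
      unfolding orthogonal_def by (subst inner_commute)
    then show ?thesis
      by (simp only: q_def inner_diff_left diff_zero one_inner[of x])
  qed
  have "(norm q)\<^sup>2 = one \<bullet> one - (\<Sum>l\<in>?I. (one \<bullet> a l)\<^sup>2)"
  proof -
    have "(norm q)\<^sup>2 = one \<bullet> q"
      using q_inner[OF q_H] by (simp add: power2_norm_eq_inner one_inner)
    then show ?thesis
      by (simp add: q_def inner_diff_right inner_sum_right power2_eq_square)
  qed
  also have "\<dots> = real (n + 1) - (\<Sum>l=1..n+1-k. (\<Sum>j\<in>UNIV. a l $ j)\<^sup>2)"
    using dim_space by (simp only: one_inner) (simp add: one_def)
  finally have norm_q: "sqrt (real (n + 1) - (\<Sum>l=1..n+1-k. (\<Sum>j\<in>UNIV. a l $ j)\<^sup>2)) = norm q"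
    by (metis norm_ge_zero real_sqrt_unique)
  show "complex_of_real (affine_vol (k - 1) (H \<inter> standard_simplex)) =
         complex_of_real (sqrt (real (n + 1) - (\<Sum>l=1..n+1-k. (\<Sum>j\<in>UNIV. a l $ j)\<^sup>2))
                            / fact (k - 1))
         * (1 / (2 * complex_of_real pi) ^ (n + 1 - k))
         * (LINT s|lborel_on ?I. ?f s)"
  proof (cases "q = 0")
    case True
    then have "H \<inter> standard_simplex = {}"
      using q_inner by (fastforce simp: standard_simplex_def)
    then have "affine_vol (k - 1) (H \<inter> standard_simplex) = 0"
      by (simp add: affine_vol_def split: prod.split)
    then show ?thesis
      unfolding norm_q using True by simp
  next
    case False
    let ?H0 = "{x \<in> H. q \<bullet> x = 0}"
    have "subspace ?H0"
      using subspace_H by (auto simp: subspace_def inner_add_right)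
    then obtain u :: "nat \<Rightarrow> real ^ 'd" where u: "orthonormal_basis_of {..<dim ?H0} u ?H0"
      using exists_orthonormal_basis by blast
    have "{x \<in> H. ((1 / norm q) *\<^sub>R q) \<bullet> x = 0} = ?H0"
      using False by auto
    then have "orthonormal_basis_of {..<Suc (dim ?H0)}
        (\<lambda>i. if i = dim ?H0 then (1 / norm q) *\<^sub>R q else u i) H"
      using u q_H False subspace_H
      by (intro orthonormal_basis_insert_normal) (simp_all add: subspace_scale)
    from card_orthonormal_basis[OF this] have m: "dim ?H0 = k - 1"
      using dim_H by simp
    note u = u[unfolded m]
    have fin: "finite ?I" by simp
    define vol where "vol = measure (lborel_on {..<k - 1}) {x \<in> space (lborel_on {..<k - 1}).
        affine_chart (k - 1) ((1 / (norm q)\<^sup>2) *\<^sub>R q) u x \<in> H \<inter> standard_simplex}"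
    have "affine_vol (k - 1) (H \<inter> standard_simplex) = vol"
      unfolding vol_def
      by (rule affine_vol_eq_measure_chart[OF subspace_H fin basis nondegenerate q_H q_inner False u])
    moreover have "(LINT s|lborel_on ?I. ?f s) = (2 * complex_of_real pi) ^ card ?I *
        complex_of_real (fact (k - 1) / norm q * vol)"
      unfolding vol_def
      by (rule section_integral_formula[OF subspace_H fin basis nondegenerate q_H q_inner False u])
    moreover have "card ?I = n + 1 - k" by simp
    ultimately show ?thesis
      unfolding norm_q using False by (simp only:) simp
  qed
qed

end
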